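(* Let $PG$ be the Petersen graph and let $f:PG\to\mathbb{R}^{2}$ be a plane generic immersion. Then \[ \sum_{\gamma\in\Gamma_{5}(PG)}\mathrm{rot}(f(\gamma))\equiv\sum_{\gamma\in\Gamma_{6}(PG)}\mathrm{rot}(f(\gamma))\equiv\sum_{\gamma\in\Gamma_{8}(PG)}\mathrm{rot}(f(\gamma))\equiv\sum_{\gamma\in\Gamma_{9}(PG)}\mathrm{rot}(f(\gamma))\equiv 1\pmod 2, \] where $\Gamma_k(PG)$ is the set of all $k$-cycles of $PG$.
   Context: The Petersen graph $PG$ has vertices $u_i,v_i$ ($i\in\mathbb{Z}/5\mathbb{Z}$) and the $15$ edges $u_iu_{i+1}$, $u_iv_i$, $v_iv_{i+2}$. A finite graph $G$ is regarded as a topological space in the usual way. A $k$-cycle of $G$ is a subgraph with $k$ edges homeomorphic to a circle. A plane generic immersion of $G$ is an immersion $f:G\to\mathbb{R}^2$ (a continuous locally injective, piecewise smooth map) whose multiple points are only finitely many transversal double points between edges, i.e. between interior points of edges (possibly of the same edge). Each cycle $\gamma$ is given an arbitrary orientation, and $\mathrm{rot}(f(\gamma))$ is the rotation number (turning number) of the oriented immersed closed plane curve $f(\gamma)$, corners at vertices being smoothed; equivalently, parametrizing $f|_\gamma$ by $c:\mathbb{R}/\mathbb{Z}\to\mathbb{R}^2$, it is the degree of $t\mapsto (c(t+\epsilon)-c(t))/\|c(t+\epsilon)-c(t)\|$ for small $\epsilon>0$. Its parity does not depend on the orientation. *)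

theory Defs
  imports "HOL-Complex_Analysis.Complex_Analysis" "HOL-Number_Theory.Cong"
begin

text \<open>A graph is given by its set of edges, an edge being the set of its two end vertices. Its
  topological realization is its geometric realization as a simplicial complex: the vertices are
  the standard basis vectors, the edges are the segments between them. (All graphs here are without
  isolated vertices, so the edges determine the graph.) The plane is \<^typ>\<open>complex\<close>.\<close>

definition vertex_point :: "'v::finite \<Rightarrow> real ^ 'v" where
  "vertex_point a = axis a 1"

definition edge_path :: "'v::finite \<Rightarrow> 'v \<Rightarrow> real \<Rightarrow> real ^ 'v" where
  "edge_path a b = linepath (vertex_point a) (vertex_point b)"

definition graph_space :: "'v::finite set set \<Rightarrow> (real ^ 'v) set" where
  "graph_space E = (\<Union>e\<in>E. convex hull (vertex_point ` e))"

text \<open>The vertex \<open>Inl i\<close> is $u_i$, the vertex \<open>Inr i\<close> is $v_i$; the type \<^typ>\<open>5\<close> is the ring of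
  integers modulo 5.\<close>

definition petersen :: "(5 + 5) set set" where
  "petersen = (\<Union>i::5. {{Inl i, Inl (i + 1)}, {Inl i, Inr i}, {Inr i, Inr (i + 2)}})"

text \<open>A subgraph homeomorphic to a circle has no isolated vertices, hence is determined by its
  edges.\<close>

definition graph_cycles :: "nat \<Rightarrow> 'v::finite set set \<Rightarrow> 'v set set set" where
  "graph_cycles k E =
     {C. C \<subseteq> E \<and> card C = k \<and> graph_space C homeomorphic sphere (0::complex) 1}"

text \<open>A parametrization of a cycle, which in particular chooses an orientation.\<close>

definition parametrizes :: "(real \<Rightarrow> real ^ 'v) \<Rightarrow> 'v::finite set set \<Rightarrow> bool" where
  "parametrizes g C \<longleftrightarrow>
     simple_path g \<and> pathfinish g = pathstart g \<and> path_image g = graph_space C"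

definition locally_injective_on ::
    "'a::topological_space set \<Rightarrow> ('a \<Rightarrow> 'b) \<Rightarrow> bool" where
  "locally_injective_on S f \<longleftrightarrow> (\<forall>x\<in>S. \<exists>U. open U \<and> x \<in> U \<and> inj_on f (S \<inter> U))"

text \<open>Piecewise smooth means piecewise $C^1$ on each edge (\<^const>\<open>valid_path\<close>). Apart from the
  double points, derivatives may vanish: immersivity is local injectivity.\<close>

definition plane_immersion :: "'v::finite set set \<Rightarrow> (real ^ 'v \<Rightarrow> complex) \<Rightarrow> bool" where
  "plane_immersion E f \<longleftrightarrow>
     continuous_on (graph_space E) f \<and>
     locally_injective_on (graph_space E) f \<and>
     (\<forall>a b. {a, b} \<in> E \<longrightarrow> valid_path (f \<circ> edge_path a b))"

definition multiple_points :: "'a set \<Rightarrow> ('a \<Rightarrow> 'b) \<Rightarrow> 'b set" where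
  "multiple_points S f = {p. \<exists>x\<in>S. \<exists>y\<in>S. x \<noteq> y \<and> f x = p \<and> f y = p}"

text \<open>The points \<open>x\<close> and \<open>y\<close> are interior points of (possibly equal) edges, at which the images of
  these edges have linearly independent tangent vectors.\<close>

definition transversal_at ::
    "'v::finite set set \<Rightarrow> (real ^ 'v \<Rightarrow> complex) \<Rightarrow> real ^ 'v \<Rightarrow> real ^ 'v \<Rightarrow> bool" where
  "transversal_at E f x y \<longleftrightarrow>
     (\<exists>a b c d s t D D'.
        {a, b} \<in> E \<and> s \<in> {0<..<1} \<and> x = edge_path a b s \<and>
        {c, d} \<in> E \<and> t \<in> {0<..<1} \<and> y = edge_path c d t \<and>
        ((f \<circ> edge_path a b) has_vector_derivative D) (at s) \<and>
        ((f \<circ> edge_path c d) has_vector_derivative D') (at t) \<and>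
        D \<noteq> D' \<and> independent {D, D'})"

definition plane_generic_immersion ::
    "'v::finite set set \<Rightarrow> (real ^ 'v \<Rightarrow> complex) \<Rightarrow> bool" where
  "plane_generic_immersion E f \<longleftrightarrow>
     plane_immersion E f \<and>
     finite (multiple_points (graph_space E) f) \<and>
     (\<forall>p \<in> multiple_points (graph_space E) f.
        \<exists>x y. x \<noteq> y \<and> {z \<in> graph_space E. f z = p} = {x, y} \<and> transversal_at E f x y)"

text \<open>The rotation number of a locally injective closed curve \<open>c\<close> on $[0,1]$: the degree of the
  direction of the secant from $c(t)$ to $c(t+\epsilon)$, for all small enough $\epsilon>0$. Here
  \<open>shiftpath \<epsilon> c\<close> is $t \mapsto c(t+\epsilon)$ with the argument read modulo 1, and the degree of a
  loop in the unit circle is its winding number around 0.\<close>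

definition rotation_number :: "(real \<Rightarrow> complex) \<Rightarrow> int" where
  "rotation_number c =
     (THE n. \<forall>\<^sub>F \<epsilon> in at_right 0.
        winding_number (\<lambda>t. sgn (shiftpath \<epsilon> c t - c t)) 0 = of_int n)"

end

theory Submission
  imports Defs
begin

text \<open>The direction of short secants of \<open>f\<close> turns by a well-defined amount along every corner
  \<open>a - b - c\<close> of the graph, from the midpoint of \<open>ab\<close> to the midpoint of \<open>bc\<close>, and the rotation
  number of a cycle is the sum of its turns. Relative to chosen logarithms of the directions at the
  edge midpoints the turns become integers \<open>m a b c\<close>, and \<open>m c b a\<close> has the same parity as
  \<open>m a b c\<close> up to a sign rule that does not depend on \<open>f\<close>. In the Petersen graph every corner lies on
  an even number of 5-, 6-, 8- and 9-cycles. So modulo 2 the sum over all \<open>k\<close>-cycles only counts the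
  corners where the sign rule intervenes, which is a finite computation. Only continuity and local
  injectivity of \<open>f\<close> enter.\<close>

section \<open>Piecewise linear walks\<close>

text \<open>The obstacle is that a corner has no integer of its own: its turn depends on the unknown
  directions at two edge midpoints. A reference logarithm is therefore fixed for every oriented
  edge; the references telescope around any cycle and drop out of its rotation number. The two
  orientations of an edge have opposite midpoint directions, so they cannot share a reference. A
  numbering of the vertices decides which orientation gets the extra half rotation, and reversing a
  corner then changes parity exactly when its middle vertex is a local maximum or minimum of the
  numbering along the corner. The even multiplicities have a conceptual source: automorphisms of the
  Petersen graph permute its 30 corners transitively, and there are 12, 10, 15, 20 cycles of length
  5, 6, 8, 9, so that every corner lies on 2, 2, 4, 6 of them. The development verifies the parity
  by evaluation instead. Orientations of cycles only multiply rotation numbers by 1 or -1, which is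
  invisible modulo 2.\<close>

definition walk :: "(int \<Rightarrow> 'v::finite) \<Rightarrow> real \<Rightarrow> real ^ 'v" where
  "walk w t = (1 - frac t) *\<^sub>R vertex_point (w \<lfloor>t\<rfloor>) + frac t *\<^sub>R vertex_point (w (\<lfloor>t\<rfloor> + 1))"

lemma norm_vertex_point_diff: "norm (vertex_point a - vertex_point b) \<le> 2"
  using norm_triangle_ineq4[of "vertex_point a" "vertex_point b"] by (simp add: vertex_point_def)

text \<open>Walks are indexed by all integers so that moving along a cycle is a translation of the
  real line. A closed walk becomes periodic, and the line serves as the universal cover of the
  cycle.\<close>

lemma walk_shift: "walk w (t + of_int i) = walk (\<lambda>j. w (j + i)) t"
  by (simp add: walk_def frac_def algebra_simps)

lemma walk_add:
  assumes "0 \<le> u" "u \<le> 1"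
  shows "walk w (of_int j + u) = (1 - u) *\<^sub>R vertex_point (w j) + u *\<^sub>R vertex_point (w (j + 1))"
proof (cases "u = 1")
  case True
  have "frac (of_int j + 1 :: real) = 0" "\<lfloor>of_int j + 1 :: real\<rfloor> = j + 1"
    by (simp_all add: frac_def)
  with True show ?thesis by (simp add: walk_def)
next
  case False
  then have "\<lfloor>of_int j + u\<rfloor> = j" using assms by linarith
  then show ?thesis by (simp add: walk_def frac_def)
qed

lemma norm_walk_diff_le: "norm (walk w s - walk w t) \<le> 2 * \<bar>s - t\<bar>"
proof (induction s t rule: linorder_wlog)
  case (le s t)
  have norm1: "norm (walk w x) \<le> 1" for x
  proof -
    have "norm (walk w x) \<le> norm ((1 - frac x) *\<^sub>R vertex_point (w \<lfloor>x\<rfloor>)) +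
        norm (frac x *\<^sub>R vertex_point (w (\<lfloor>x\<rfloor> + 1)))"
      unfolding walk_def by (rule norm_triangle_ineq)
    also have "\<dots> = 1" using frac_lt_1[of x] by (simp add: vertex_point_def)
    finally show ?thesis .
  qed
  let ?v = "\<lambda>i. vertex_point (w i)"
  \<comment> \<open>Walks stay in the unit ball, which settles distant parameters. Parameters on
    adjacent edges are compared through the shared vertex
    \<open>w \<lfloor>t\<rfloor>\<close>.\<close>
  consider "t - s \<ge> 1" | "\<lfloor>s\<rfloor> = \<lfloor>t\<rfloor>" | "\<lfloor>t\<rfloor> = \<lfloor>s\<rfloor> + 1" using le by linarith
  then show ?case
  proof cases
    case 1
    then show ?thesis using norm_triangle_ineq4[of "walk w s" "walk w t"] norm1[of s] norm1[of t] by simp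
  next
    case 2
    then have "walk w s - walk w t = (s - t) *\<^sub>R (?v (\<lfloor>t\<rfloor> + 1) - ?v \<lfloor>t\<rfloor>)"
      by (simp add: walk_def frac_def algebra_simps)
    then show ?thesis
      using mult_right_mono[OF norm_vertex_point_diff[of "w (\<lfloor>t\<rfloor> + 1)" "w \<lfloor>t\<rfloor>"], of "\<bar>s - t\<bar>"]
      by (simp add: mult.commute)
  next
    case 3
    then have "walk w s - walk w t =
        (1 - frac s) *\<^sub>R (?v \<lfloor>s\<rfloor> - ?v \<lfloor>t\<rfloor>) + frac t *\<^sub>R (?v \<lfloor>t\<rfloor> - ?v (\<lfloor>t\<rfloor> + 1))"
      by (simp add: walk_def algebra_simps)
    also have "norm \<dots> \<le> (1 - frac s) * norm (?v \<lfloor>s\<rfloor> - ?v \<lfloor>t\<rfloor>) + frac t * norm (?v \<lfloor>t\<rfloor> - ?v (\<lfloor>t\<rfloor> + 1))"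
      using frac_lt_1[of s] by (intro order.trans[OF norm_triangle_ineq]) simp
    also have "\<dots> \<le> (1 - frac s) * 2 + frac t * 2"
      using frac_lt_1[of s] by (intro add_mono mult_left_mono norm_vertex_point_diff) auto
    also have "\<dots> = 2 * \<bar>s - t\<bar>" using 3 le by (simp add: frac_def)
    finally show ?thesis .
  qed
next
  case (sym a b)
  then show ?case by (simp add: norm_minus_commute abs_minus_commute)
qed

lemma continuous_on_walk: "continuous_on A (walk w)"
  by (rule lipschitz_on_continuous_on[of 2], rule lipschitz_onI)
     (auto simp: dist_norm intro: norm_walk_diff_le)

lemma range_walk: "range (walk w) = graph_space (range (\<lambda>j. {w j, w (j + 1)}))"
proof -
  have seg: "convex hull (vertex_point ` {w j, w (j + 1)}) = (\<lambda>u. walk w (of_int j + u)) ` {0..1}" for j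
    by (auto simp: segment_convex_hull[symmetric] closed_segment_def walk_add image_iff)
  have "x = of_int \<lfloor>x\<rfloor> + frac x" "frac x \<in> {0..1}" for x :: real
    using frac_lt_1[of x] by (auto simp: frac_def)
  then have "walk w x \<in> (\<Union>j. (\<lambda>u. walk w (of_int j + u)) ` {0..1})" for x
    by (metis (no_types, lifting) UN_I UNIV_I imageI)
  then show ?thesis unfolding graph_space_def by (auto simp: seg simp del: image_insert)
qed

lemma walk_nth_pos_iff:
  "(walk w t) $ v > 0 \<longleftrightarrow> v = w \<lfloor>t\<rfloor> \<or> (frac t > 0 \<and> v = w (\<lfloor>t\<rfloor> + 1))"
  using frac_lt_1[of t] frac_ge_0[of t] by (auto simp: walk_def vertex_point_def axis_def)

section \<open>Closed walks and their parameters\<close>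

definition cyclic_seq :: "int \<Rightarrow> (int \<Rightarrow> 'v) \<Rightarrow> bool" where
  "cyclic_seq k w \<longleftrightarrow> 3 \<le> k \<and> (\<forall>i j. w i = w j \<longleftrightarrow> k dvd i - j)"

lemma cyclic_seq_add [simp]:
  assumes "cyclic_seq k w" shows "w (i + k * n) = w i"
  using assms by (simp add: cyclic_seq_def)

text \<open>The positive barycentric coordinates of a point reveal the edge it lies on, and the
  coordinate at the far end reveals the position on that edge.\<close>

lemma walk_eq_iff:
  assumes "cyclic_seq k w"
  shows "walk w s = walk w t \<longleftrightarrow> (\<exists>n::int. s = t + of_int k * of_int n)"
proof
  assume eq: "walk w s = walk w t"
  let ?i = "\<lfloor>s\<rfloor>" and ?j = "\<lfloor>t\<rfloor>"
  have w: "w i = w j \<longleftrightarrow> k dvd i - j" and "3 \<le> k" for i j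
    using assms by (auto simp: cyclic_seq_def)
  have ne: "w j \<noteq> w (j + 1)" for j using \<open>3 \<le> k\<close> by (simp add: w zdvd_not_zless)
  have fr: "walk w x $ w (\<lfloor>x\<rfloor> + 1) = frac x" for x
    using ne[of "\<lfloor>x\<rfloor>"] by (simp add: walk_def vertex_point_def axis_def)
  have "w ?i = w ?j"
  proof (rule ccontr)
    assume neq: "w ?i \<noteq> w ?j"
    have "walk w t $ w ?i > 0" "walk w s $ w ?j > 0"
      using eq walk_nth_pos_iff[of w s] walk_nth_pos_iff[of w t] by auto
    then have "w ?i = w (?j + 1)" "w ?j = w (?i + 1)" using neq by (auto simp: walk_nth_pos_iff)
    \<comment> \<open>This is the case of one edge traversed in opposite directions. Adding the two
      divisibilities leaves \<open>k dvd 2\<close>, which is where a period of at least 3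
      enters.\<close>
    then have "k dvd ?i - (?j + 1)" "k dvd ?j - (?i + 1)" by (auto simp: w)
    from dvd_add[OF this] have "k dvd 2" by simp
    with \<open>3 \<le> k\<close> show False by (simp add: zdvd_not_zless)
  qed
  then obtain n where n: "?i - ?j = k * n" by (auto simp: w elim: dvdE)
  then have "w (?i + 1) = w (?j + 1)" by (simp add: w)
  then have "frac s = frac t" using fr[of s] fr[of t] eq by simp
  then have "s = t + of_int (?i - ?j)" by (simp add: frac_def)
  then show "\<exists>n::int. s = t + of_int k * of_int n" unfolding n by auto
next
  assume "\<exists>n::int. s = t + of_int k * of_int n"
  then obtain n :: int where "s = t + of_int (k * n)" by auto
  then show "walk w s = walk w t"
    using assms by (simp only: walk_shift cyclic_seq_add)
qed

lemma walk_neq: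
  assumes "cyclic_seq k w" "s \<noteq> t" "\<bar>s - t\<bar> < of_int k"
  shows "walk w s \<noteq> walk w t"
proof
  assume "walk w s = walk w t"
  then obtain n :: int where n: "s = t + of_int k * of_int n" using walk_eq_iff[OF assms(1)] by blast
  then have "n \<noteq> 0" using assms by auto
  then have "1 \<le> \<bar>real_of_int n\<bar>" by linarith
  then have "of_int \<bar>k\<bar> * 1 \<le> \<bar>real_of_int k\<bar> * \<bar>real_of_int n\<bar>" by (intro mult_mono) auto
  moreover have "real_of_int k > 0" using assms(1) by (simp add: cyclic_seq_def)
  ultimately show False using n assms(3) by (simp add: abs_mult)
qed

lemma range_walk_eq:
  assumes "cyclic_seq k w"
  shows "range (walk w) = walk w ` {0..of_int k}"
proof -
  have k: "real_of_int k > 0" using assms by (simp add: cyclic_seq_def)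
  have "walk w t \<in> walk w ` {0..of_int k}" for t
  proof
    let ?s = "t + of_int k * of_int (- \<lfloor>t / of_int k\<rfloor>)"
    show "walk w t = walk w ?s" using walk_eq_iff[OF assms, of ?s t] by metis
    have "?s = of_int k * frac (t / of_int k)" using k by (simp add: frac_def field_simps)
    then show "?s \<in> {0..of_int k}" using k frac_lt_1[of "t / of_int k"] by simp
  qed
  then show ?thesis by auto
qed

lemma cyclic_seq_homeomorphic_circle:
  assumes "cyclic_seq k w"
  shows "range (walk w) homeomorphic sphere (0::complex) 1"
proof -
  have k: "real_of_int k > 0" using assms by (simp add: cyclic_seq_def)
  let ?p = "\<lambda>u. walk w (of_int k * u)"
  have 1: "path_image ?p = range (walk w)"
  proof -
    have "{0..of_int k} = (\<lambda>u. of_int k * u) ` {0..1::real}" using k by simp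
    then show ?thesis unfolding range_walk_eq[OF assms] path_image_def by (simp only: image_image)
  qed
  have 2: "simple_path ?p"
  proof (rule simple_pathI)
    show "path ?p" unfolding path_def
      by (rule continuous_on_compose2[OF continuous_on_walk[of UNIV]]) (auto intro!: continuous_intros)
    fix x y :: real assume xy: "0 \<le> x" "x < y" "y \<le> 1" "?p x = ?p y"
    show "x = 0 \<and> y = 1"
    proof (rule ccontr)
      assume "\<not> (x = 0 \<and> y = 1)"
      then have "\<bar>x - y\<bar> < 1" using xy by auto
      then have "\<bar>of_int k * x - of_int k * y\<bar> < of_int k"
        using k by (simp add: right_diff_distrib[symmetric] abs_mult)
      then show False using walk_neq[OF assms, of "of_int k * x" "of_int k * y"] xy k by simp
    qed
  qed
  have "?p 0 = ?p 1"
    using walk_eq_iff[OF assms, of "of_int k" 0] by (auto intro: exI[of _ 1])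
  then show ?thesis
    using homeomorphic_simple_path_image_circle[OF 2, of 1 0] 1 by (simp add: pathfinish_def pathstart_def)
qed

section \<open>Rotation numbers through lifts\<close>

lemma winding_number_log:
  assumes "continuous_on {0..1} l" "\<And>t. t \<in> {0..1} \<Longrightarrow> p t = exp (l t)"
  shows "winding_number p 0 = (l 1 - l 0) / (2 * of_real pi * \<i>)"
proof -
  have "winding_number p 0 = winding_number (exp \<circ> l) 0"
    using assms(2) by (intro winding_number_cong) auto
  then show ?thesis
    using winding_number_compose_exp[of l] assms(1)
    by (simp add: path_def pathstart_def pathfinish_def)
qed

text \<open>The difference takes values in a set with spacing \<open>2 * pi\<close>, so it cannot
  vary on a connected set.\<close>

lemma continuous_logs_differ_by_constant:
  fixes l1 l2 :: "'a::topological_space \<Rightarrow> complex"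
  assumes "connected S" "continuous_on S l1" "continuous_on S l2"
    and "\<And>x. x \<in> S \<Longrightarrow> exp (l1 x) = exp (l2 x)"
  obtains n :: int where "\<And>x. x \<in> S \<Longrightarrow> l1 x = l2 x + 2 * of_real pi * \<i> * of_int n"
proof -
  have int: "\<exists>n::int. l1 x - l2 x = 2 * of_real pi * \<i> * of_int n" if "x \<in> S" for x
    using assms(4)[OF that] unfolding exp_eq by (auto simp: algebra_simps)
  have "(\<lambda>x. l1 x - l2 x) constant_on S"
  proof (rule continuous_discrete_range_constant[OF assms(1)])
    show "continuous_on S (\<lambda>x. l1 x - l2 x)" by (intro continuous_intros assms)
    fix x assume "x \<in> S"
    show "\<exists>e>0. \<forall>y. y \<in> S \<and> l1 y - l2 y \<noteq> l1 x - l2 x \<longrightarrow> e \<le> norm (l1 y - l2 y - (l1 x - l2 x))"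
    proof (intro exI[of _ "2 * pi"] conjI allI impI)
      fix y assume y: "y \<in> S \<and> l1 y - l2 y \<noteq> l1 x - l2 x"
      obtain m n :: int where mn: "l1 x - l2 x = 2 * of_real pi * \<i> * of_int m"
          "l1 y - l2 y = 2 * of_real pi * \<i> * of_int n"
        using int y \<open>x \<in> S\<close> by metis
      then have "m \<noteq> n" using y by auto
      then have "1 \<le> \<bar>real_of_int (n - m)\<bar>" by linarith
      moreover have "l1 y - l2 y - (l1 x - l2 x) = 2 * of_real pi * \<i> * of_int (n - m)"
        by (simp add: mn algebra_simps)
      then have "norm (l1 y - l2 y - (l1 x - l2 x)) = 2 * pi * \<bar>real_of_int (n - m)\<bar>"
        by (simp add: norm_mult del: of_int_diff)
      ultimately show "2 * pi \<le> norm (l1 y - l2 y - (l1 x - l2 x))"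
        using mult_left_mono[of 1 "\<bar>real_of_int (n - m)\<bar>" "2 * pi"] by simp
    qed simp
  qed
  then obtain c where c: "\<And>x. x \<in> S \<Longrightarrow> l1 x - l2 x = c" unfolding constant_on_def by auto
  show thesis
  proof (cases "S = {}")
    case False
    then obtain x n where "x \<in> S" "l1 x - l2 x = 2 * of_real pi * \<i> * of_int n" using int by blast
    then show ?thesis using that[of n] c by (metis add.commute diff_add_cancel)
  qed (use that in auto)
qed

lemma sgn_exp: "sgn (exp z) = exp (\<i> * of_real (Im z))"
  unfolding sgn_div_norm exp_eq_polar[of z] cis_conv_exp[symmetric]
  by (simp add: norm_mult scaleR_conv_of_real)

text \<open>A simple closed curve covers the circle with degree \<open>\<sigma> = \<plusminus>1\<close>: a larger degree would make
  it return to its base point at an interior parameter, and degree 0 would make its lift fold back.\<close>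

lemma simple_loop_lift:
  assumes w: "cyclic_seq k w"
    and g: "simple_path g" "pathfinish g = pathstart g" "path_image g = range (walk w)"
  obtains h and \<sigma> :: int where
    "continuous_on {0..1} h" "\<And>t. t \<in> {0..1} \<Longrightarrow> g t = walk w (h t)"
    "h 1 = h 0 + of_int (\<sigma> * k)" "\<sigma> = 1 \<or> \<sigma> = -1"
proof -
  have k: "real_of_int k > 0" using w by (simp add: cyclic_seq_def)
  \<comment> \<open>The angle coordinate on the cycle: one period \<open>k\<close> of the walk
    corresponds to one full circle.\<close>
  define e where "e t = exp (\<i> * of_real (2 * pi * t / of_int k))" for t :: real
  have e_eq: "e s = e t \<longleftrightarrow> walk w s = walk w t" for s t
  proof -
    have "e s = e t \<longleftrightarrow> (\<exists>n::int. 2 * pi * s / of_int k = 2 * pi * t / of_int k + 2 * pi * of_int n)"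
      unfolding e_def exp_eq by (simp add: complex_eq_iff mult_ac)
    also have "\<dots> \<longleftrightarrow> (\<exists>n::int. s = t + of_int k * of_int n)"
    proof -
      have "2 * pi * s / of_int k = 2 * pi * t / of_int k + 2 * pi * of_int n \<longleftrightarrow>
          (2 * pi) * s = (2 * pi) * (t + of_int k * of_int n)" for n :: int
        using k by (simp only: distrib_left) (simp add: field_simps)
      then show ?thesis by simp
    qed
    finally show ?thesis using walk_eq_iff[OF w] by simp
  qed
  define \<phi> where "\<phi> z = e (SOME t. walk w t = z)" for z
  have \<phi>: "\<phi> (walk w t) = e t" for t
    unfolding \<phi>_def e_eq by (rule someI) (rule refl)
  have cont_e: "continuous_on A e" for A unfolding e_def using k by (intro continuous_intros) auto
  \<comment> \<open>The choice in \<open>\<phi>\<close> says nothing about continuity. It follows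
    from the closed graph criterion: the graph of \<open>\<phi>\<close> is the continuous image of
    one compact period.\<close>
  have "continuous_on (range (walk w)) \<phi>"
  proof (rule continuous_from_closed_graph[of "sphere 0 1"])
    show "\<phi> \<in> range (walk w) \<rightarrow> sphere 0 1" by (auto simp: \<phi> e_def)
    have "(\<lambda>z. (z, \<phi> z)) ` range (walk w) = (\<lambda>t. (walk w t, e t)) ` {0..of_int k}"
      unfolding range_walk_eq[OF w] by (simp add: image_image \<phi>)
    also have "compact \<dots>"
      by (intro compact_continuous_image continuous_intros continuous_on_walk cont_e compact_Icc)
    finally show "closed ((\<lambda>z. (z, \<phi> z)) ` range (walk w))" by (rule compact_imp_closed)
  qed simp
  moreover have contg: "continuous_on {0..1} g" using g(1) by (simp add: simple_path_def path_def)
  ultimately have cont\<phi>g: "continuous_on {0..1} (\<lambda>t. \<phi> (g t))"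
    by (rule continuous_on_compose2) (use g(3) in \<open>auto simp: path_image_def\<close>)
  have \<phi>_nz: "\<phi> z \<noteq> 0" for z by (simp add: \<phi>_def e_def)
  obtain l where l: "continuous_on {0..1} l" "\<And>t. t \<in> {0..1} \<Longrightarrow> \<phi> (g t) = exp (l t)"
    using continuous_logarithm_on_contractible[OF cont\<phi>g convex_imp_contractible \<phi>_nz] by auto
  \<comment> \<open>The lifted angle, rescaled back to a parameter of the walk.\<close>
  define h where "h t = Im (l t) * of_int k / (2 * pi)" for t
  have gh: "g t = walk w (h t)" if t: "t \<in> {0..1}" for t
  proof -
    have "g t \<in> range (walk w)" using g(3) t unfolding path_image_def by blast
    then obtain s where s: "g t = walk w s" by blast
    have "norm (\<phi> (g t)) = 1" by (simp add: s \<phi> e_def)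
    then have "Re (l t) = 0" using l(2)[OF t] by simp
    then have "l t = \<i> * of_real (Im (l t))" by (simp add: complex_eq_iff)
    then have "e (h t) = e s"
      using l(2)[OF t] k by (simp add: s \<phi> e_def h_def)
    then show ?thesis using s e_eq by simp
  qed
  have conth: "continuous_on {0..1} h" unfolding h_def by (intro continuous_intros l) auto
  have inj: "s = t \<or> s = 0 \<and> t = 1 \<or> s = 1 \<and> t = 0"
    if "s \<in> {0..1}" "t \<in> {0..1}" "h s = h t + of_int k * of_int n" for s t and n :: int
  proof -
    have "g s = g t" unfolding gh[OF that(1)] gh[OF that(2)] walk_eq_iff[OF w] using that by blast
    then show ?thesis using g(1) that by (auto simp: simple_path_def loop_free_def)
  qed
  have "walk w (h 1) = walk w (h 0)" using gh[of 0] gh[of 1] g(2) by (simp add: pathfinish_def pathstart_def)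
  then obtain n :: int where n: "h 1 = h 0 + of_int k * of_int n" using walk_eq_iff[OF w] by blast
  have ivt: "\<exists>x\<in>{a..b}. h x = y" if "0 \<le> a" "a \<le> b" "b \<le> 1" "y \<in> closed_segment (h a) (h b)" for a b y
  proof -
    have "continuous_on {a..b} h" using that by (intro continuous_on_subset[OF conth]) auto
    then show ?thesis
      using that IVT'[of h a y b] IVT2'[of h b y a] by (auto simp: closed_segment_eq_real_ivl split: if_splits)
  qed
  have "n \<noteq> 0"
  proof
    assume "n = 0"
    \<comment> \<open>With degree 0 the lift goes from \<open>h 0\<close> to \<open>h (1/2)\<close>
      and back, so it takes the halfway value on both sides of 1/2, against injectivity.\<close>
    let ?y = "(h 0 + h (1/2)) / 2"
    have "?y \<in> closed_segment (h 0) (h (1/2))" "?y \<in> closed_segment (h (1/2)) (h 1)"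
      using n \<open>n = 0\<close> by (auto simp: closed_segment_eq_real_ivl)
    then obtain a b where ab: "a \<in> {0..1/2}" "h a = ?y" "b \<in> {1/2..1}" "h b = ?y"
      using ivt[of 0 "1/2" ?y] ivt[of "1/2" 1 ?y] by auto
    have "h (1/2) \<noteq> h 0" using inj[of "1/2" 0 0] by auto
    then have "a \<noteq> 0" using ab by auto
    have "a \<noteq> 1/2"
    proof
      assume "a = 1/2"
      with ab(2) have "h (1/2) = (h 0 + h (1/2)) / 2" by metis
      then show False using \<open>h (1/2) \<noteq> h 0\<close> by simp
    qed
    then show False using \<open>a \<noteq> 0\<close> inj[of a b 0] ab by auto
  qed
  moreover have "\<bar>n\<bar> \<le> 1"
  proof (rule ccontr)
    assume "\<not> \<bar>n\<bar> \<le> 1"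
    then have n2: "n \<ge> 2 \<or> n \<le> -2" by linarith
    \<comment> \<open>A lift of degree beyond 1 in absolute value must pass the end of its first
      full circuit strictly before the parameter 1.\<close>
    have "h 0 + of_int k * of_int (sgn n) \<in> closed_segment (h 0) (h 1)"
    proof -
      have "real_of_int k * 1 \<le> of_int k * of_int n" if "n \<ge> 2"
        using k that by (intro mult_left_mono) auto
      moreover have "real_of_int k * of_int n \<le> of_int k * (-1)" if "n \<le> -2"
        using k that by (intro mult_left_mono) auto
      ultimately show ?thesis using n2 k n by (auto simp: closed_segment_eq_real_ivl)
    qed
    then obtain a where a: "a \<in> {0..1}" "h a = h 0 + of_int k * of_int (sgn n)" using ivt[of 0 1] by (metis order_refl zero_le_one)
    then have "a = 0 \<or> a = 1" using inj[of a 0 "sgn n"] by auto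
    then have "of_int k * real_of_int (sgn n) = of_int k * 0 \<or> of_int k * real_of_int (sgn n) = of_int k * of_int n"
      using a n by auto
    then have "real_of_int (sgn n) = 0 \<or> real_of_int (sgn n) = of_int n" using k unfolding mult_cancel_left by simp
    then have "sgn n = 0 \<or> sgn n = n" by linarith
    then show False using n2 by (auto simp: sgn_if split: if_splits)
  qed
  ultimately have "n = 1 \<or> n = -1" by linarith
  then show thesis by (intro that[OF conth gh, of n]) (auto simp: n mult.commute)
qed

text \<open>The secants of \<open>c\<close> are chords of \<open>F\<close> between close parameters,
  and \<open>\<Lambda>\<close> is a continuous logarithm of all such chords with ordered ends.
  Injectivity of \<open>h\<close> keeps the two ends apart, so their order never changes during one
  circuit. The degree is thus read off from the change of \<open>\<Lambda>\<close> under one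
  period.\<close>

lemma rotation_number_lift:
  fixes F :: "real \<Rightarrow> complex" and k \<sigma> n :: int
  assumes r: "r > 0"
    and \<Lambda>: "continuous_on {(s, t). s < t \<and> t < s + r} \<Lambda>"
      "\<And>s t. s < t \<Longrightarrow> t < s + r \<Longrightarrow> F t - F s = exp (\<Lambda> (s, t))"
      "\<And>s t. s < t \<Longrightarrow> t < s + r \<Longrightarrow>
        \<Lambda> (s + of_int (\<sigma> * k), t + of_int (\<sigma> * k)) = \<Lambda> (s, t) + 2 * of_real pi * \<i> * of_int n"
    and per: "\<And>t. F (t + of_int (\<sigma> * k)) = F t"
    and h: "continuous_on {0..1} h" "h 1 = h 0 + of_int (\<sigma> * k)"
      "\<And>s t. s \<in> {0..1} \<Longrightarrow> t \<in> {0..1} \<Longrightarrow> h s = h t \<or> h s + of_int (\<sigma> * k) = h t \<Longrightarrow>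
          s = t \<or> s = 0 \<and> t = 1 \<or> s = 1 \<and> t = 0"
    and c: "\<And>t. t \<in> {0..1} \<Longrightarrow> c t = F (h t)"
  shows "rotation_number c = n"
proof -
  define K where "K = real_of_int (\<sigma> * k)"
  \<comment> \<open>Continuing \<open>h\<close> quasi-periodically to [0,2] turns the wrap-around of
    \<open>shiftpath\<close> into a plain translation by \<open>\<epsilon>\<close>.\<close>
  define H where "H t = (if t \<le> 1 then h t else h (t - 1) + K)" for t
  have contH: "continuous_on {0..2} H"
  proof -
    have "continuous_on ({0..1} \<union> {1..2}) H" unfolding H_def
    proof (rule continuous_on_If)
      show "continuous_on {0..1} h" by (rule h)
      show "continuous_on {1..2} (\<lambda>t. h (t - 1) + K)"
        by (intro continuous_intros continuous_on_compose2[OF h(1)]) auto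
    qed (auto simp: h(2) K_def)
    also have "{0..1} \<union> {1..2} = {0..2::real}" by auto
    finally show ?thesis .
  qed
  then have "uniformly_continuous_on {0..2} H" by (rule compact_uniformly_continuous) simp
  then obtain d where d: "d > 0"
      "\<And>x y. x \<in> {0..2} \<Longrightarrow> y \<in> {0..2} \<Longrightarrow> dist y x < d \<Longrightarrow> dist (H y) (H x) < r"
    using r unfolding uniformly_continuous_on_def by metis
  have wind: "winding_number (\<lambda>t. sgn (shiftpath \<epsilon> c t - c t)) 0 = of_int n"
    if \<epsilon>: "0 < \<epsilon>" "\<epsilon> < min d 1" for \<epsilon>
  proof -
    have contHe: "continuous_on {0..1} (\<lambda>t. H (t + \<epsilon>))" "continuous_on {0..1} H"
      using \<epsilon> by (auto intro!: continuous_on_compose2[OF contH] continuous_intros)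
    have near: "\<bar>H (t + \<epsilon>) - H t\<bar> < r" if "t \<in> {0..1}" for t
      using d(2)[of t "t + \<epsilon>"] that \<epsilon> by (auto simp: dist_real_def)
    have ne: "H (t + \<epsilon>) \<noteq> H t" if "t \<in> {0..1}" for t
    proof (cases "t + \<epsilon> \<le> 1")
      case True
      then show ?thesis using h(3)[of "t + \<epsilon>" t] that \<epsilon> by (auto simp: H_def)
    next
      case False
      then show ?thesis using h(3)[of "t + \<epsilon> - 1" t] that \<epsilon> by (auto simp: H_def K_def)
    qed
    have chord: "shiftpath \<epsilon> c t - c t = F (H (t + \<epsilon>)) - F (H t)" if "t \<in> {0..1}" for t
      using that \<epsilon> c[of "t + \<epsilon>"] c[of "t + \<epsilon> - 1"] c[of t] per[of "h (t + \<epsilon> - 1)"]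
      by (auto simp: shiftpath_def H_def K_def add.commute)
    have H1: "H 1 = H 0 + K" "H (1 + \<epsilon>) = H \<epsilon> + K"
      using \<epsilon> h(2) by (auto simp: H_def K_def)
    obtain l where l: "continuous_on {0..1} l" "l 1 = l 0 + 2 * of_real pi * \<i> * of_int n"
        "\<And>t. t \<in> {0..1} \<Longrightarrow> shiftpath \<epsilon> c t - c t = exp (l t)"
    proof -
      \<comment> \<open>A continuous difference without zeros on an interval has constant
        sign.\<close>
      have "(\<forall>t\<in>{0..1}. H t < H (t + \<epsilon>)) \<or> (\<forall>t\<in>{0..1}. H (t + \<epsilon>) < H t)"
      proof (rule ccontr)
        assume "\<not> ?thesis"
        then obtain a b where ab: "a \<in> {0..1}" "b \<in> {0..1}" "H (a + \<epsilon>) - H a \<le> 0" "0 \<le> H (b + \<epsilon>) - H b"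
          by (auto simp: not_less)
        have "connected ((\<lambda>t. H (t + \<epsilon>) - H t) ` {0..1})"
          by (intro connected_continuous_image continuous_intros contHe) auto
        then have "0 \<in> (\<lambda>t. H (t + \<epsilon>) - H t) ` {0..1}"
          using ab unfolding connected_iff_interval by blast
        then show False using ne by auto
      qed
      then show thesis
      proof
        assume pos: "\<forall>t\<in>{0..1}. H t < H (t + \<epsilon>)"
        then have S: "H t < H (t + \<epsilon>) \<and> H (t + \<epsilon>) < H t + r" if "t \<in> {0..1}" for t
          using near[OF that] that by auto
        show thesis
        proof (rule that[of "\<lambda>t. \<Lambda> (H t, H (t + \<epsilon>))"])
          show "continuous_on {0..1} (\<lambda>t. \<Lambda> (H t, H (t + \<epsilon>)))"
            by (intro continuous_on_compose2[OF \<Lambda>(1)] continuous_intros contHe) (use S in auto)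
          show "\<Lambda> (H 1, H (1 + \<epsilon>)) = \<Lambda> (H 0, H (0 + \<epsilon>)) + 2 * of_real pi * \<i> * of_int n"
            using \<Lambda>(3)[of "H 0" "H \<epsilon>"] S[of 0] by (simp add: H1 K_def)
        qed (use S \<Lambda>(2) chord in auto)
      next
        assume neg: "\<forall>t\<in>{0..1}. H (t + \<epsilon>) < H t"
        then have S: "H (t + \<epsilon>) < H t \<and> H t < H (t + \<epsilon>) + r" if "t \<in> {0..1}" for t
          using near[OF that] that by auto
        show thesis
        \<comment> \<open>\<open>\<Lambda>\<close> only knows chords with increasing ends. The
          secant is the negative of such a chord, hence the constant
          \<open>of_real pi * \<i>\<close>, which cancels in the degree.\<close>
        proof (rule that[of "\<lambda>t. \<Lambda> (H (t + \<epsilon>), H t) + of_real pi * \<i>"])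
          show "continuous_on {0..1} (\<lambda>t. \<Lambda> (H (t + \<epsilon>), H t) + of_real pi * \<i>)"
            by (intro continuous_on_compose2[OF \<Lambda>(1)] continuous_intros contHe) (use S in auto)
          show "\<Lambda> (H (1 + \<epsilon>), H 1) + of_real pi * \<i> =
              \<Lambda> (H (0 + \<epsilon>), H 0) + of_real pi * \<i> + 2 * of_real pi * \<i> * of_int n"
            using \<Lambda>(3)[of "H \<epsilon>" "H 0"] S[of 0] by (simp add: H1 K_def)
          fix t :: real assume t: "t \<in> {0..1}"
          have "F (H (t + \<epsilon>)) - F (H t) = - (F (H t) - F (H (t + \<epsilon>)))" by simp
          also have "\<dots> = exp (\<Lambda> (H (t + \<epsilon>), H t) + of_real pi * \<i>)"
            using \<Lambda>(2) S[OF t] by (simp add: exp_add)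
          finally show "shiftpath \<epsilon> c t - c t = exp (\<Lambda> (H (t + \<epsilon>), H t) + of_real pi * \<i>)"
            using chord[OF t] by simp
        qed
      qed
    qed
    have "winding_number (\<lambda>t. sgn (shiftpath \<epsilon> c t - c t)) 0 =
        (\<i> * of_real (Im (l 1)) - \<i> * of_real (Im (l 0))) / (2 * of_real pi * \<i>)"
      by (rule winding_number_log) (use l in \<open>auto simp: sgn_exp intro!: continuous_intros\<close>)
    also have "\<dots> = of_int n" by (simp add: l(2) field_simps)
    finally show ?thesis .
  qed
  then have ev: "\<forall>\<^sub>F \<epsilon> in at_right 0. winding_number (\<lambda>t. sgn (shiftpath \<epsilon> c t - c t)) 0 = of_int n"
    using d(1) by (auto simp: eventually_at_right_field intro!: exI[of _ "min d 1"])
  show ?thesis unfolding rotation_number_def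
  proof (rule the_equality, rule ev)
    fix m :: int
    assume "\<forall>\<^sub>F \<epsilon> in at_right 0. winding_number (\<lambda>t. sgn (shiftpath \<epsilon> c t - c t)) 0 = of_int m"
    with ev have "\<forall>\<^sub>F \<epsilon> in at_right (0::real). m = n" by eventually_elim simp
    then show "m = n" by simp
  qed
qed

section \<open>Turns at corners\<close>

definition cyc_seq :: "'v list \<Rightarrow> int \<Rightarrow> 'v" where
  "cyc_seq L j = L ! nat (j mod int (length L))"

definition cyc_edges :: "'v list \<Rightarrow> 'v set set" where
  "cyc_edges L = range (\<lambda>j. {cyc_seq L j, cyc_seq L (j + 1)})"

definition is_cycle :: "'v set set \<Rightarrow> 'v list \<Rightarrow> bool" where
  "is_cycle E L \<longleftrightarrow> distinct L \<and> 3 \<le> length L \<and> cyc_edges L \<subseteq> E"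

lemma cyclic_seq_cyc_seq:
  assumes "distinct L" "3 \<le> length L"
  shows "cyclic_seq (int (length L)) (cyc_seq L)"
proof -
  have "0 < int (length L)" using assms(2) by linarith
  then have nonneg: "0 \<le> i mod int (length L)" and lt: "nat (i mod int (length L)) < length L" for i
    by (simp_all add: nat_less_iff)
  have "cyc_seq L i = cyc_seq L j \<longleftrightarrow> int (length L) dvd i - j" for i j
  proof -
    have "cyc_seq L i = cyc_seq L j \<longleftrightarrow> nat (i mod int (length L)) = nat (j mod int (length L))"
      unfolding cyc_seq_def using assms(1) lt by (simp add: nth_eq_iff_index_eq)
    also have "\<dots> \<longleftrightarrow> i mod int (length L) = j mod int (length L)"
      using nonneg by (simp add: eq_nat_nat_iff)
    finally show ?thesis by (simp add: mod_eq_dvd_iff)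
  qed
  then show ?thesis using assms(2) by (simp add: cyclic_seq_def)
qed

lemma walk_cong:
  assumes "0 \<le> t" "t < 2" "w 0 = w' 0" "w 1 = w' 1" "w 2 = w' 2"
  shows "walk w t = walk w' t"
proof -
  have "\<lfloor>t\<rfloor> = 0 \<or> \<lfloor>t\<rfloor> = 1" using assms(1,2) by linarith
  then show ?thesis using assms by (auto simp: walk_def)
qed

lemma walk_in_graph_space: "{w \<lfloor>t\<rfloor>, w (\<lfloor>t\<rfloor> + 1)} \<in> E \<Longrightarrow> walk w t \<in> graph_space E"
  unfolding graph_space_def
  by (rule UN_I) (use frac_lt_1[of t] in
    \<open>auto simp: walk_def segment_convex_hull[symmetric] closed_segment_def intro!: exI[of _ "frac t"]\<close>)

lemma edge_path_swap: "edge_path b a s = edge_path a b (1 - s)"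
  by (simp add: edge_path_def linepath_def)

text \<open>Local injectivity made uniform. The bound \<open>2 * r\<close> matches the Lipschitz
  constant 2 of walks, so parameters at most \<open>r\<close> apart have different images;
  \<open>r \<le> 1\<close> keeps these parameters within one period and the chords at edge midpoints
  inside their edges.\<close>

locale locally_injective_graph_map =
  fixes E :: "'v::finite set set" and f :: "real ^ 'v \<Rightarrow> complex" and r :: real
  assumes cont: "continuous_on (graph_space E) f"
    and r_pos: "0 < r" and r_le: "r \<le> 1"
    and sep: "\<And>x y. x \<in> graph_space E \<Longrightarrow> y \<in> graph_space E \<Longrightarrow> x \<noteq> y \<Longrightarrow> dist x y \<le> 2 * r \<Longrightarrow> f x \<noteq> f y"
begin

definition chord :: "(int \<Rightarrow> 'v) \<Rightarrow> real \<Rightarrow> complex" where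
  "chord w t = f (walk w (t + r / 4)) - f (walk w (t - r / 4))"

text \<open>The chord at an edge midpoint depends on the oriented edge alone, not on the cycle or
  corner through it. This lets turns be cut and reglued there.\<close>

definition midchord :: "'v \<Rightarrow> 'v \<Rightarrow> complex" where
  "midchord a b = f (edge_path a b (1/2 + r/4)) - f (edge_path a b (1/2 - r/4))"

text \<open>The winding number of an open path, hence complex: the real part is the rotation in full
  turns, the imaginary part records the change of chord length. \<open>cyc_seq\<close> merely
  supplies a sequence with values a, b, c at 0, 1, 2; the parameters used lie between 1/4 and 7/4,
  so the wrap-around edge from c to a, possibly absent from the graph, is never visited.\<close>

definition turn :: "'v \<Rightarrow> 'v \<Rightarrow> 'v \<Rightarrow> complex" where
  "turn a b c = winding_number (\<lambda>t. chord (cyc_seq [a, b, c]) (t + 1/2)) 0"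

definition corner :: "'v \<Rightarrow> 'v \<Rightarrow> 'v \<Rightarrow> bool" where
  "corner a b c \<longleftrightarrow> {a, b} \<in> E \<and> {b, c} \<in> E \<and> distinct [a, b, c]"

lemma corner_swap: "corner a b c \<Longrightarrow> corner c b a"
  by (auto simp: corner_def insert_commute)

lemma f_walk_neq:
  assumes "cyclic_seq k w" "s < t" "t \<le> s + r" "walk w s \<in> graph_space E" "walk w t \<in> graph_space E"
  shows "f (walk w s) \<noteq> f (walk w t)"
proof (rule sep[OF assms(4,5)])
  have "3 \<le> real_of_int k" using assms(1) by (simp add: cyclic_seq_def)
  then show "walk w s \<noteq> walk w t" using assms r_le by (intro walk_neq[OF assms(1)]) auto
  have "dist (walk w s) (walk w t) \<le> 2 * \<bar>s - t\<bar>" unfolding dist_norm by (rule norm_walk_diff_le)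
  then show "dist (walk w s) (walk w t) \<le> 2 * r" using assms(2,3) by auto
qed

lemma midchord_swap: "midchord b a = - midchord a b"
  by (simp add: midchord_def edge_path_swap[of b a])

lemma corner_cyclic: "corner a b c \<Longrightarrow> cyclic_seq 3 (cyc_seq [a, b, c])"
  using cyclic_seq_cyc_seq[of "[a, b, c]"] by (simp add: corner_def)

lemma corner_seq [simp]:
  "cyc_seq [a, b, c] 0 = a" "cyc_seq [a, b, c] 1 = b" "cyc_seq [a, b, c] 2 = c"
  by (simp_all add: cyc_seq_def nat_numeral)

lemma corner_walk_in:
  assumes "corner a b c" "0 \<le> t" "t < 2"
  shows "walk (cyc_seq [a, b, c]) t \<in> graph_space E"
proof -
  have "\<lfloor>t\<rfloor> = 0 \<or> \<lfloor>t\<rfloor> = 1" using assms(2,3) by linarith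
  then show ?thesis using assms(1) by (intro walk_in_graph_space) (auto simp: corner_def)
qed

lemma corner_chord:
  assumes "corner a b c" "t \<in> {0..1}"
  shows "chord (cyc_seq [a, b, c]) (t + 1/2) \<noteq> 0"
  using f_walk_neq[OF corner_cyclic[OF assms(1)], of "t + 1/2 - r/4" "t + 1/2 + r/4"] assms r_pos r_le
  by (auto simp: chord_def corner_walk_in)

lemma continuous_on_corner_chord:
  assumes "corner a b c"
  shows "continuous_on {0..1} (\<lambda>t. chord (cyc_seq [a, b, c]) (t + 1/2))"
  unfolding chord_def using r_pos r_le
  by (intro continuous_intros continuous_on_compose2[OF cont] continuous_on_compose2[OF continuous_on_walk[of UNIV]])
     (auto intro!: corner_walk_in[OF assms])

lemma corner_log:
  assumes "corner a b c"
  obtains l where "continuous_on {0..1} l"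
    "\<And>t. t \<in> {0..1} \<Longrightarrow> chord (cyc_seq [a, b, c]) (t + 1/2) = exp (l t)"
    "turn a b c = (l 1 - l 0) / (2 * of_real pi * \<i>)"
proof -
  obtain l where l: "continuous_on {0..1} l"
    "\<And>t. t \<in> {0..1} \<Longrightarrow> chord (cyc_seq [a, b, c]) (t + 1/2) = exp (l t)"
    using continuous_logarithm_on_contractible[OF continuous_on_corner_chord[OF assms]
        convex_imp_contractible corner_chord[OF assms]] by auto
  with that[OF this] winding_number_log[OF l] show thesis by (simp add: turn_def)
qed

lemma chord_midpoint:
  "chord w (1/2) = midchord (w 0) (w 1)" "chord w (3/2) = midchord (w 1) (w 2)"
proof -
  have *: "walk w (of_int j + u) = edge_path (w j) (w (j + 1)) u" if "0 \<le> u" "u \<le> 1" for j u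
    unfolding walk_add[OF that] by (simp add: edge_path_def linepath_def)
  show "chord w (1/2) = midchord (w 0) (w 1)"
    using *[of "1/2 + r/4" 0] *[of "1/2 - r/4" 0] r_pos r_le by (simp add: chord_def midchord_def)
  have "3/2 + r/4 = of_int 1 + (1/2 + r/4)" "3/2 - r/4 = of_int 1 + (1/2 - r/4)" by auto
  then show "chord w (3/2) = midchord (w 1) (w 2)"
    using *[of "1/2 + r/4" 1] *[of "1/2 - r/4" 1] r_pos r_le
    by (simp only: chord_def midchord_def) simp
qed

lemma midchord_turn:
  assumes "corner a b c"
  shows "midchord b c = exp (2 * of_real pi * \<i> * turn a b c) * midchord a b" and "midchord a b \<noteq> 0"
proof -
  obtain l where l: "\<And>t. t \<in> {0..1} \<Longrightarrow> chord (cyc_seq [a, b, c]) (t + 1/2) = exp (l t)"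
    "turn a b c = (l 1 - l 0) / (2 * of_real pi * \<i>)" using corner_log[OF assms] by metis
  have "midchord a b = exp (l 0)" "midchord b c = exp (l 1)"
    using l(1)[of 0] l(1)[of 1] chord_midpoint[of "cyc_seq [a, b, c]"] by simp_all
  moreover have "2 * of_real pi * \<i> * turn a b c = l 1 - l 0" by (simp add: l(2))
  ultimately show "midchord b c = exp (2 * of_real pi * \<i> * turn a b c) * midchord a b" "midchord a b \<noteq> 0"
    by (simp_all add: exp_add[symmetric])
qed

text \<open>Reversal runs through the chords backwards and negates each one. The negation adds a
  constant to the logarithm, so only the reversal of time affects the turn.\<close>

lemma turn_swap:
  assumes "corner a b c"
  shows "turn c b a = - turn a b c"
proof -
  obtain l where l: "continuous_on {0..1} l"
    "\<And>t. t \<in> {0..1} \<Longrightarrow> chord (cyc_seq [a, b, c]) (t + 1/2) = exp (l t)"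
    "turn a b c = (l 1 - l 0) / (2 * of_real pi * \<i>)" using corner_log[OF assms] by metis
  have rev: "walk (cyc_seq [c, b, a]) t = walk (cyc_seq [a, b, c]) (2 - t)" if "0 < t" "t < 2" for t
  proof -
    let ?w = "cyc_seq [a, b, c]" and ?w' = "cyc_seq [c, b, a]"
    have "t = of_int 0 + t" "2 - t = of_int 1 + (1 - t)" if "t \<le> 1" by auto
    moreover have "t = of_int 1 + (t - 1)" "2 - t = of_int 0 + (2 - t)" if "t > 1" by auto
    moreover have "walk ?w' (of_int 0 + t) = walk ?w (of_int 1 + (1 - t))" if "t \<le> 1"
      using that \<open>0 < t\<close> by (subst (1 2) walk_add) auto
    moreover have "walk ?w' (of_int 1 + (t - 1)) = walk ?w (of_int 0 + (2 - t))" if "t > 1"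
      using that \<open>t < 2\<close> by (subst (1 2) walk_add) auto
    ultimately show ?thesis by (metis not_le)
  qed
  have "turn c b a = ((l (1 - 1) + of_real pi * \<i>) - (l (1 - 0) + of_real pi * \<i>)) / (2 * of_real pi * \<i>)"
    unfolding turn_def
  proof (rule winding_number_log)
    show "continuous_on {0..1} (\<lambda>t. l (1 - t) + of_real pi * \<i>)"
      by (intro continuous_intros continuous_on_compose2[OF l(1)]) auto
    fix t :: real assume t: "t \<in> {0..1}"
    have "chord (cyc_seq [c, b, a]) (t + 1/2) = - chord (cyc_seq [a, b, c]) ((1 - t) + 1/2)"
      using t r_pos r_le rev[of "t + 1/2 + r/4"] rev[of "t + 1/2 - r/4"]
      by (simp add: chord_def algebra_simps)
    also have "\<dots> = exp (l (1 - t) + of_real pi * \<i>)" using l(2)[of "1 - t"] t by (simp add: exp_add)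
    finally show "chord (cyc_seq [c, b, a]) (t + 1/2) = exp (l (1 - t) + of_real pi * \<i>)" .
  qed
  also have "\<dots> = - turn a b c" by (simp add: l(3) diff_divide_distrib)
  finally show ?thesis .
qed

lemma cycle_corner:
  assumes "is_cycle E L"
  shows "corner (cyc_seq L i) (cyc_seq L (i + 1)) (cyc_seq L (i + 2))"
proof -
  have w: "cyc_seq L i = cyc_seq L j \<longleftrightarrow> int (length L) dvd i - j" for i j
    using cyclic_seq_cyc_seq[of L] assms by (simp add: is_cycle_def cyclic_seq_def)
  have e: "{cyc_seq L j, cyc_seq L (j + 1)} \<in> E" for j
    using assms by (auto simp: is_cycle_def cyc_edges_def)
  have "\<not> int (length L) dvd 1" "\<not> int (length L) dvd 2"
    using assms by (auto simp: is_cycle_def dest!: zdvd_imp_le)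
  moreover have "{cyc_seq L (i + 1), cyc_seq L (i + 2)} \<in> E"
    using e[of "i + 1"] by (simp only: add.assoc one_add_one)
  ultimately show ?thesis using e[of i] by (auto simp: corner_def w)
qed

text \<open>All short chords of the periodic curve share one logarithm on the strip
  \<open>s < t \<and> t < s + r\<close>, which is convex and hence contractible. Its change under
  one period is \<open>n\<close> full turns. Moving along the centred chords splits \<open>n\<close>
  into turns at corners, while the given parametrization sees \<open>n\<close> up to its orientation
  \<open>\<sigma>\<close>.\<close>

lemma rotation_number_cycle:
  assumes L: "is_cycle E L" and g: "parametrizes g (cyc_edges L)"
  obtains \<sigma> :: int where "\<sigma> = 1 \<or> \<sigma> = -1"
    "of_int (rotation_number (f \<circ> g)) = of_int \<sigma> *
      (\<Sum>i<length L. turn (cyc_seq L (int i)) (cyc_seq L (int i + 1)) (cyc_seq L (int i + 2)))"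
proof -
  define w where "w = cyc_seq L"
  define k where "k = int (length L)"
  have w: "cyclic_seq k w" unfolding w_def k_def using L by (intro cyclic_seq_cyc_seq) (auto simp: is_cycle_def)
  have range: "range (walk w) = graph_space (cyc_edges L)" unfolding w_def cyc_edges_def by (rule range_walk)
  also have "\<dots> \<subseteq> graph_space E" using L by (auto simp: graph_space_def is_cycle_def)
  finally have inE: "walk w t \<in> graph_space E" for t by auto
  define F where "F t = f (walk w t)" for t
  have contF: "continuous_on A F" for A
    unfolding F_def by (rule continuous_on_compose2[OF cont continuous_on_walk]) (auto simp: inE)
  have per: "F (t + of_int (k * n)) = F t" for t n
  proof -
    have "walk w (t + of_int (k * n)) = walk w t"
      unfolding walk_eq_iff[OF w] by (rule exI[of _ n]) simp
    then show ?thesis by (simp only: F_def)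
  qed
  let ?S = "{(s, t). s < t \<and> t < s + r}"
  have convS: "convex ?S"
  proof -
    have "?S = {z. (-1, 1) \<bullet> z > (0::real)} \<inter> {z. (-1, 1) \<bullet> z < r}" by (auto simp: inner_prod_def)
    then show ?thesis by (simp only: convex_Int convex_halfspace_gt convex_halfspace_lt)
  qed
  have contF2: "continuous_on ?S (\<lambda>z. F (snd z) - F (fst z))"
    by (intro continuous_intros continuous_on_compose2[OF contF[of UNIV]]) auto
  have F2: "F (snd z) - F (fst z) \<noteq> 0" if "z \<in> ?S" for z
    using f_walk_neq[OF w, of "fst z" "snd z"] inE that by (auto simp: F_def)
  obtain \<Lambda> where \<Lambda>: "continuous_on ?S \<Lambda>" "\<And>z. z \<in> ?S \<Longrightarrow> F (snd z) - F (fst z) = exp (\<Lambda> z)"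
    using continuous_logarithm_on_contractible[OF contF2 convex_imp_contractible[OF convS] F2] by blast
  let ?sh = "\<lambda>z::real \<times> real. (fst z + of_int k, snd z + of_int k)"
  obtain n where n: "\<And>z. z \<in> ?S \<Longrightarrow> \<Lambda> (?sh z) = \<Lambda> z + 2 * of_real pi * \<i> * of_int n"
  proof (rule continuous_logs_differ_by_constant[OF convex_connected[OF convS]])
    show "continuous_on ?S (\<lambda>z. \<Lambda> (?sh z))"
      by (intro continuous_on_compose2[OF \<Lambda>(1)] continuous_intros) auto
    show "continuous_on ?S \<Lambda>" by (rule \<Lambda>)
    fix z assume "z \<in> ?S"
    then show "exp (\<Lambda> (?sh z)) = exp (\<Lambda> z)"
      using \<Lambda>(2)[of "?sh z"] \<Lambda>(2)[of z] per[of "fst z" 1] per[of "snd z" 1] by auto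
  qed blast
  obtain h \<sigma> where h: "continuous_on {0..1} h" "\<And>t. t \<in> {0..1} \<Longrightarrow> g t = walk w (h t)"
      "h 1 = h 0 + of_int (\<sigma> * k)" and \<sigma>: "\<sigma> = 1 \<or> \<sigma> = -1"
    using simple_loop_lift[OF w, of g] g unfolding parametrizes_def range by metis
  have "rotation_number (f \<circ> g) = \<sigma> * n"
  proof (rule rotation_number_lift[OF r_pos \<Lambda>(1), where F = F and k = k and \<sigma> = \<sigma> and h = h])
    fix s t :: real
    show "F (t + of_int (\<sigma> * k)) = F t" using per[of t \<sigma>] by (simp add: mult.commute)
    show "s < t \<Longrightarrow> t < s + r \<Longrightarrow> F t - F s = exp (\<Lambda> (s, t))" using \<Lambda>(2)[of "(s, t)"] by simp
    \<comment> \<open>For \<open>\<sigma> = -1\<close> the period relation is used at the pair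
      shifted back by \<open>k\<close>.\<close>
    show "s < t \<Longrightarrow> t < s + r \<Longrightarrow> \<Lambda> (s + of_int (\<sigma> * k), t + of_int (\<sigma> * k)) =
        \<Lambda> (s, t) + 2 * of_real pi * \<i> * of_int (\<sigma> * n)"
      using \<sigma> n[of "(s, t)"] n[of "(s - of_int k, t - of_int k)"] by auto
    show "t \<in> {0..1} \<Longrightarrow> (f \<circ> g) t = F (h t)" using h(2) by (simp add: F_def)
    assume st: "s \<in> {0..1}" "t \<in> {0..1}" "h s = h t \<or> h s + of_int (\<sigma> * k) = h t"
    have "\<exists>j::int. h t = h s + of_int k * of_int j"
      using st(3) by (elim disjE) (rule exI[of _ 0], simp, rule exI[of _ \<sigma>], simp add: mult.commute)
    then have "g s = g t" using st h(2) walk_eq_iff[OF w, of "h t" "h s"] by auto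
    then show "s = t \<or> s = 0 \<and> t = 1 \<or> s = 1 \<and> t = 0"
      using g st by (auto simp: parametrizes_def simple_path_def loop_free_def)
  qed (use h in auto)
  moreover have "of_int n = (\<Sum>i<length L. turn (w (int i)) (w (int i + 1)) (w (int i + 2)))"
  proof -
    \<comment> \<open>The logarithm of the chord of width r/2 centred at x + 1/2; integers x
      correspond to edge midpoints.\<close>
    define G where "G x = \<Lambda> (x + 1/2 - r/4, x + 1/2 + r/4)" for x
    have contG: "continuous_on A G" for A
      unfolding G_def by (rule continuous_on_compose2[OF \<Lambda>(1)]) (use r_pos in \<open>auto intro!: continuous_intros\<close>)
    have step: "2 * of_real pi * \<i> * turn (w i) (w (i + 1)) (w (i + 2)) = G (of_int i + 1) - G (of_int i)" for i
    proof -
      have "turn (w i) (w (i + 1)) (w (i + 2)) = (G (of_int i + 1) - G (of_int i + 0)) / (2 * of_real pi * \<i>)"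
        unfolding turn_def
      proof (rule winding_number_log)
        show "continuous_on {0..1} (\<lambda>t. G (of_int i + t))"
          by (intro continuous_on_compose2[OF contG[of UNIV]] continuous_intros) auto
        fix t :: real assume t: "t \<in> {0..1}"
        \<comment> \<open>On parameters from 0 up to but excluding 2 a walk only sees three
          consecutive vertices, so the corner's walk is a piece of the cycle's walk.\<close>
        have "walk (cyc_seq [w i, w (i + 1), w (i + 2)]) x = walk w (of_int i + x)" if "0 \<le> x" "x < 2" for x
          unfolding add.commute[of "of_int i" x] walk_shift using that
          by (intro walk_cong) (auto simp: add.commute)
        from this[of "t + 1/2 + r/4"] this[of "t + 1/2 - r/4"]
        have "chord (cyc_seq [w i, w (i + 1), w (i + 2)]) (t + 1/2) =
            F (of_int i + t + 1/2 + r/4) - F (of_int i + t + 1/2 - r/4)"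
          using t r_pos r_le by (simp add: chord_def F_def algebra_simps)
        then show "chord (cyc_seq [w i, w (i + 1), w (i + 2)]) (t + 1/2) = exp (G (of_int i + t))"
          using \<Lambda>(2)[of "(of_int i + t + 1/2 - r/4, of_int i + t + 1/2 + r/4)"] r_pos by (simp add: G_def)
      qed
      then show ?thesis by simp
    qed
    have "2 * of_real pi * \<i> * (\<Sum>i<length L. turn (w (int i)) (w (int i + 1)) (w (int i + 2))) =
        (\<Sum>i<length L. G (real (Suc i)) - G (real i))"
      unfolding sum_distrib_left step by (simp add: add.commute)
    also have "\<dots> = G (of_int k) - G 0" by (subst sum_lessThan_telescope) (simp add: k_def)
    also have "\<dots> = 2 * of_real pi * \<i> * of_int n"
      using n[of "(1/2 - r/4, 1/2 + r/4)"] r_pos by (simp add: G_def algebra_simps)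
    finally show ?thesis by simp
  qed
  ultimately show thesis using that[OF \<sigma>] by (simp add: w_def)
qed

text \<open>Reversing a corner negates its turn but shifts the reference directions of both edges by half
  a rotation, up or down according to the order of their ends.\<close>

lemma corner_integers:
  fixes idx :: "'v \<Rightarrow> nat"
  assumes idx: "inj idx"
  obtains m :: "'v \<Rightarrow> 'v \<Rightarrow> 'v \<Rightarrow> int" where
    "\<And>a b c. corner a b c \<Longrightarrow> odd (m a b c + m c b a) \<longleftrightarrow> (idx a < idx b \<longleftrightarrow> idx c < idx b)"
    "\<And>L g. is_cycle E L \<Longrightarrow> parametrizes g (cyc_edges L) \<Longrightarrow>
      [rotation_number (f \<circ> g) =
        (\<Sum>i<length L. m (cyc_seq L (int i)) (cyc_seq L (int i + 1)) (cyc_seq L (int i + 2)))] (mod 2)"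
proof -
  define A0 where "A0 a b = Ln (midchord a b) / (2 * of_real pi * \<i>)" for a b
  \<comment> \<open>Reference angles in full rotations. Only the orientation towards the larger
    number uses its own \<open>Ln\<close>; the other takes the opposite angle, which still is a
    logarithm of its own midchord.\<close>
  define A where "A a b = (if idx a < idx b then A0 a b else A0 b a + 1/2)" for a b
  have A: "exp (2 * of_real pi * \<i> * A a b) = midchord a b" if "midchord a b \<noteq> 0" for a b
  proof -
    have "2 * of_real pi * \<i> * A a b = (if idx a < idx b then Ln (midchord a b) else Ln (midchord b a) + of_real pi * \<i>)"
      by (simp add: A_def A0_def algebra_simps)
    then show ?thesis using that midchord_swap[of a b] by (simp add: exp_add)
  qed
  have A_swap: "A b a = A a b + (if idx a < idx b then 1/2 else -1/2)" if "a \<noteq> b" for a b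
    using that injD[OF idx, of a b] by (auto simp: A_def)
  \<comment> \<open>The turn corrected by the references at both ends is already an integer, as
    shown next; \<open>\<lfloor>_\<rfloor>\<close> and \<open>Re\<close> only convert the
    type.\<close>
  define m where "m a b c = \<lfloor>Re (turn a b c - A b c + A a b)\<rfloor>" for a b c
  have m: "of_int (m a b c) = turn a b c - A b c + A a b" if "corner a b c" for a b c
  proof -
    have ne: "midchord a b \<noteq> 0" "midchord b c \<noteq> 0"
      using midchord_turn[OF that] midchord_turn(2)[OF corner_swap[OF that]] midchord_swap[of b c] by auto
    have "exp (2 * of_real pi * \<i> * (turn a b c + A a b)) = exp (2 * of_real pi * \<i> * A b c)"
      using midchord_turn(1)[OF that] ne by (simp add: A distrib_left exp_add)
    then obtain n :: int where "2 * of_real pi * \<i> * (turn a b c + A a b) = 2 * of_real pi * \<i> * A b c + (of_int (2 * n) * pi) * \<i>"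
      unfolding exp_eq by blast
    then have "(2 * of_real pi * \<i>) * (turn a b c - A b c + A a b) = (2 * of_real pi * \<i>) * of_int n"
      by (simp add: algebra_simps)
    then have "turn a b c - A b c + A a b = of_int n" by simp
    then show ?thesis by (simp add: m_def)
  qed
  show thesis
  proof (rule that)
    fix a b c assume abc: "corner a b c"
    then have "a \<noteq> b" "c \<noteq> b" by (auto simp: corner_def)
    have "complex_of_int (m a b c + m c b a) = (A a b - A b a) + (A c b - A b c)"
      using m[OF abc] m[OF corner_swap[OF abc]] turn_swap[OF abc] by simp
    \<comment> \<open>Each of the two edges contributes -1/2 if its outer end has the smaller number
      and 1/2 otherwise; the contributions add up to an odd integer exactly when they agree.\<close>
    also have "\<dots> = of_int (if idx a < idx b then (if idx c < idx b then -1 else 0) else (if idx c < idx b then 0 else 1))"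
      using A_swap[OF \<open>a \<noteq> b\<close>] A_swap[OF \<open>c \<noteq> b\<close>] by auto
    finally show "odd (m a b c + m c b a) \<longleftrightarrow> (idx a < idx b \<longleftrightarrow> idx c < idx b)"
      unfolding of_int_eq_iff by auto
  next
    fix L g assume L: "is_cycle E L" and g: "parametrizes g (cyc_edges L)"
    let ?w = "cyc_seq L" and ?s = "\<lambda>F. \<Sum>i<length L. F (int i)"
    obtain \<sigma> :: int where \<sigma>: "\<sigma> = 1 \<or> \<sigma> = -1" "of_int (rotation_number (f \<circ> g)) = of_int \<sigma> *
      ?s (\<lambda>i. turn (?w i) (?w (i + 1)) (?w (i + 2)))"
      using rotation_number_cycle[OF L g] by blast
    \<comment> \<open>Each oriented edge of the cycle ends one corner and begins the next, so its
      reference cancels.\<close>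
    have tele: "?s (\<lambda>i. A (?w (i + 1)) (?w (i + 2)) - A (?w i) (?w (i + 1))) = 0"
    proof -
      have "?s (\<lambda>i. A (?w (i + 1)) (?w (i + 2)) - A (?w i) (?w (i + 1))) =
          (\<Sum>i<length L. A (?w (int (Suc i))) (?w (int (Suc i) + 1)) - A (?w (int i)) (?w (int i + 1)))"
      proof -
        have "int (Suc i) = int i + 1" "int i + 1 + 1 = int i + 2" for i by simp_all
        then show ?thesis by (simp only:)
      qed
      also have "\<dots> = A (?w (int (length L))) (?w (int (length L) + 1)) - A (?w 0) (?w 1)"
        by (subst sum_lessThan_telescope) simp
      also have "\<dots> = 0" by (simp add: cyc_seq_def)
      finally show ?thesis .
    qed
    have "complex_of_int (?s (\<lambda>i. m (?w i) (?w (i + 1)) (?w (i + 2)))) =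
        ?s (\<lambda>i. turn (?w i) (?w (i + 1)) (?w (i + 2)) -
            (A (?w (i + 1)) (?w (i + 2)) - A (?w i) (?w (i + 1))))"
      unfolding of_int_sum m[OF cycle_corner[OF L]] by (simp add: algebra_simps)
    also have "\<dots> = ?s (\<lambda>i. turn (?w i) (?w (i + 1)) (?w (i + 2)))"
      by (subst sum_subtractf) (simp only: tele diff_0_right)
    finally have "complex_of_int (rotation_number (f \<circ> g)) =
        of_int (\<sigma> * ?s (\<lambda>i. m (?w i) (?w (i + 1)) (?w (i + 2))))"
      using \<sigma>(2) by simp
    then have "rotation_number (f \<circ> g) = \<sigma> * ?s (\<lambda>i. m (?w i) (?w (i + 1)) (?w (i + 2)))"
      unfolding of_int_eq_iff .
    then show "[rotation_number (f \<circ> g) = ?s (\<lambda>i. m (?w i) (?w (i + 1)) (?w (i + 2)))] (mod 2)"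
      using \<sigma>(1) by (auto simp: cong_def) presburger
  qed
qed

end

section \<open>Cycles of a graph\<close>

lemma compact_graph_space: "compact (graph_space E)"
  unfolding graph_space_def by (intro compact_UN finite_imp_compact_convex_hull) auto

text \<open>A Lebesgue number argument on the compact graph. The quarter of
  \<open>\<epsilon>\<close> makes the permitted distance \<open>2 * r\<close> at most half of the
  Lebesgue number.\<close>

lemma plane_immersion_locally_injective:
  assumes "plane_immersion E f"
  obtains r where "locally_injective_graph_map E f r"
proof -
  let ?X = "graph_space E"
  have "?X \<subseteq> \<Union> {U. open U \<and> inj_on f (?X \<inter> U)}"
    using assms unfolding plane_immersion_def locally_injective_on_def by blast
  then obtain \<epsilon> where \<epsilon>: "0 < \<epsilon>" "\<And>x. x \<in> ?X \<Longrightarrow> \<exists>U\<in>{U. open U \<and> inj_on f (?X \<inter> U)}. ball x \<epsilon> \<subseteq> U"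
    by (rule Heine_Borel_lemma[OF compact_graph_space]) auto
  have "locally_injective_graph_map E f (min 1 (\<epsilon> / 4))"
  proof
    show "continuous_on ?X f" using assms by (simp add: plane_immersion_def)
    fix x y assume xy: "x \<in> ?X" "y \<in> ?X" "x \<noteq> y" "dist x y \<le> 2 * min 1 (\<epsilon> / 4)"
    then obtain U where "inj_on f (?X \<inter> U)" "ball x \<epsilon> \<subseteq> U" using \<epsilon>(2) by blast
    moreover have "x \<in> ball x \<epsilon>" "y \<in> ball x \<epsilon>" using xy(4) \<epsilon>(1) by auto
    ultimately show "f x \<noteq> f y" using xy(1-3) inj_onD[of f "?X \<inter> U" x y] by blast
  qed (use \<epsilon> in auto)
  then show thesis by (rule that)
qed

section \<open>Subgraphs homeomorphic to a circle\<close>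

definition simple_graph :: "'v set set \<Rightarrow> bool" where
  "simple_graph E \<longleftrightarrow> (\<forall>e\<in>E. \<exists>a b. a \<noteq> b \<and> e = {a, b})"

lemma in_graph_space_iff:
  assumes "simple_graph E"
  shows "z \<in> graph_space E \<longleftrightarrow>
    (\<exists>a b u. {a, b} \<in> E \<and> a \<noteq> b \<and> 0 \<le> u \<and> u \<le> 1 \<and> z = (1 - u) *\<^sub>R vertex_point a + u *\<^sub>R vertex_point b)"
proof -
  have hull: "convex hull (vertex_point ` {a, b}) = closed_segment (vertex_point a) (vertex_point b)" for a b :: 'a
    by (simp add: segment_convex_hull)
  show ?thesis
  proof
    assume "z \<in> graph_space E"
    then obtain e where e: "e \<in> E" "z \<in> convex hull (vertex_point ` e)" by (auto simp: graph_space_def)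
    then obtain a b where "a \<noteq> b" "e = {a, b}" using assms by (auto simp: simple_graph_def)
    with e show "\<exists>a b u. {a, b} \<in> E \<and> a \<noteq> b \<and> 0 \<le> u \<and> u \<le> 1 \<and> z = (1 - u) *\<^sub>R vertex_point a + u *\<^sub>R vertex_point b"
      unfolding closed_segment_def by (auto simp: hull closed_segment_def simp del: image_insert)
  next
    assume "\<exists>a b u. {a, b} \<in> E \<and> a \<noteq> b \<and> 0 \<le> u \<and> u \<le> 1 \<and> z = (1 - u) *\<^sub>R vertex_point a + u *\<^sub>R vertex_point b"
    then obtain a b where "{a, b} \<in> E" "z \<in> convex hull (vertex_point ` {a, b})"
      unfolding hull closed_segment_def by blast
    then show "z \<in> graph_space E" unfolding graph_space_def by (rule UN_I)
  qed
qed

text \<open>Exactly the two ends of an edge have nonzero coordinates at its midpoint. This makes the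
  edge set recoverable from the space.\<close>

lemma edge_midpoint_in_iff:
  assumes "simple_graph E" "a \<noteq> b"
  shows "(1/2) *\<^sub>R vertex_point a + (1/2) *\<^sub>R vertex_point b \<in> graph_space E \<longleftrightarrow> {a, b} \<in> E" (is "?m \<in> _ \<longleftrightarrow> _")
proof
  assume "?m \<in> graph_space E"
  then obtain c d u where cd: "{c, d} \<in> E" "c \<noteq> d" "?m = (1 - u) *\<^sub>R vertex_point c + u *\<^sub>R vertex_point d"
    unfolding in_graph_space_iff[OF assms(1)] by blast
  have "?m $ a \<noteq> 0" "?m $ b \<noteq> 0" using assms(2) by (auto simp: vertex_point_def axis_def)
  then have "{a, b} = {c, d}" using assms(2) unfolding cd(3) by (auto simp: vertex_point_def axis_def split: if_splits)
  with cd show "{a, b} \<in> E" by simp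
next
  assume "{a, b} \<in> E"
  then show "?m \<in> graph_space E"
    unfolding in_graph_space_iff[OF assms(1)] using assms(2)
    by (intro exI[of _ a] exI[of _ b] exI[of _ "1/2"]) auto
qed

text \<open>A missing edge would make Z a proper part of a circle. Placed in the unit circle, it
  could not separate the plane, but a homeomorphic copy of the circle must do so by the Jordan curve
  theorem.\<close>

lemma circle_subgraph_eq:
  assumes C: "simple_graph C" "graph_space C homeomorphic sphere (0::complex) 1"
    and Z: "Z \<subseteq> C" "graph_space Z homeomorphic sphere (0::complex) 1"
  shows "Z = C"
proof (rule ccontr)
  assume "Z \<noteq> C"
  have sZ: "simple_graph Z" using C(1) Z(1) by (auto simp: simple_graph_def)
  obtain e where "e \<in> C" "e \<notin> Z" using \<open>Z \<noteq> C\<close> Z(1) by blast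
  moreover from \<open>e \<in> C\<close> obtain a b where "a \<noteq> b" "e = {a, b}" using C(1) unfolding simple_graph_def by metis
  ultimately have ab: "a \<noteq> b" "{a, b} \<in> C" "{a, b} \<notin> Z" by simp_all
  have sub: "graph_space Z \<subset> graph_space C"
    using edge_midpoint_in_iff[OF C(1) ab(1)] edge_midpoint_in_iff[OF sZ ab(1)] ab Z(1)
    by (auto simp: graph_space_def)
  obtain \<phi> \<psi> where \<phi>: "homeomorphism (graph_space C) (sphere (0::complex) 1) \<phi> \<psi>"
    using C(2) unfolding homeomorphic_def by blast
  have "inj_on \<phi> (graph_space C)" using \<phi> by (metis homeomorphism_apply1 inj_on_inverseI)
  then have "\<phi> ` graph_space Z \<subset> \<phi> ` graph_space C"
    using sub by (simp add: psubset_eq image_mono inj_on_image_eq_iff)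
  then have "\<phi> ` graph_space Z \<subset> sphere 0 1" using homeomorphism_image1[OF \<phi>] by simp
  then have "connected (- \<phi> ` graph_space Z)"
    by (intro Jordan_Brouwer_nonseparation[of "sphere (0::complex) 1" 0 1]) (auto simp: homeomorphic_refl)
  moreover have "graph_space Z homeomorphic \<phi> ` graph_space Z"
    using homeomorphism_of_subsets[OF \<phi>, of "graph_space Z"] sub unfolding homeomorphic_def by blast
  then have "\<not> connected (- \<phi> ` graph_space Z)"
    using Z(2) by (intro Jordan_Brouwer_separation[of _ 0 1]) (auto intro: homeomorphic_trans homeomorphic_sym[THEN iffD1])
  ultimately show False by blast
qed

lemma connected_circle_minus_point:
  assumes "S homeomorphic sphere (0::complex) 1"
  shows "connected (S - {p})"
proof (cases "p \<in> S")
  case True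
  obtain \<phi> \<psi> where \<phi>: "homeomorphism S (sphere (0::complex) 1) \<phi> \<psi>"
    using assms unfolding homeomorphic_def by blast
  have "\<phi> p \<in> sphere 0 1" using \<phi> True by (auto simp: homeomorphism_def)
  then have "sphere 0 1 - {\<phi> p} homeomorphic {x::complex. 1 \<bullet> x = 0}"
    by (intro homeomorphic_punctured_sphere_hyperplane) auto
  moreover have "connected {x::complex. 1 \<bullet> x = 0}"
    by (intro convex_connected convex_hyperplane)
  ultimately have "connected (sphere 0 1 - {\<phi> p})" using homeomorphic_connectedness by blast
  moreover have "continuous_on (sphere 0 1 - {\<phi> p}) \<psi>"
    using \<phi> by (auto simp: homeomorphism_def intro: continuous_on_subset)
  moreover have "\<psi> ` (sphere 0 1 - {\<phi> p}) = S - {p}"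
    using \<phi> True by (force simp: homeomorphism_def)
  ultimately show ?thesis by (metis connected_continuous_image)
next
  case False
  then show ?thesis using assms homeomorphic_connectedness[OF assms] connected_sphere[of "0::complex" 1] by simp
qed

text \<open>If y were a leaf, the midpoint of its edge would be the only point with y-coordinate
  1/2. Removing it would separate x from y, whereas a circle minus a point stays connected.\<close>

lemma circle_graph_no_leaf:
  assumes C: "simple_graph C" "graph_space C homeomorphic sphere (0::complex) 1"
    and xy: "{x, y} \<in> C" "x \<noteq> y"
  shows "\<exists>z. z \<noteq> x \<and> z \<noteq> y \<and> {y, z} \<in> C"
proof (rule ccontr)
  assume "\<not> ?thesis"
  then have leaf: "z = x" if "{y, z} \<in> C" "z \<noteq> y" for z using that by blast
  define p where "p = (1/2) *\<^sub>R vertex_point x + (1/2) *\<^sub>R vertex_point y"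
  have half: "z = p" if z: "z \<in> graph_space C" "z $ y = 1/2" for z
  proof -
    obtain a b u where ab: "{a, b} \<in> C" "a \<noteq> b" "z = (1 - u) *\<^sub>R vertex_point a + u *\<^sub>R vertex_point b"
      using z(1) unfolding in_graph_space_iff[OF C(1)] by blast
    have "a = y \<or> b = y" using z(2) ab(3) by (auto simp: vertex_point_def axis_def split: if_splits)
    then have "a = y \<and> b = x \<and> u = 1/2 \<or> a = x \<and> b = y \<and> u = 1/2"
      using leaf[of a] leaf[of b] ab z(2) by (auto simp: vertex_point_def axis_def insert_commute)
    then show ?thesis unfolding ab(3) p_def by (elim disjE conjE; hypsubst) (simp_all add: add.commute)
  qed
  have "connected (graph_space C - {p})" by (rule connected_circle_minus_point[OF C(2)])
  then have conn: "connected ((\<lambda>z. z $ y) ` (graph_space C - {p}))"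
    by (intro connected_continuous_image continuous_intros) auto
  have vp: "vertex_point x \<in> graph_space C" "vertex_point y \<in> graph_space C"
    using hull_subset[of "vertex_point ` {x, y}" convex] xy(1) unfolding graph_space_def by blast+
  have coord: "vertex_point x $ y = 0" "vertex_point y $ y = 1" "p $ y = 1/2"
    using xy(2) by (auto simp: vertex_point_def axis_def p_def)
  then have "vertex_point x \<noteq> p" "vertex_point y \<noteq> p" by auto
  then have "vertex_point x $ y \<in> (\<lambda>z. z $ y) ` (graph_space C - {p})"
      "vertex_point y $ y \<in> (\<lambda>z. z $ y) ` (graph_space C - {p})"
    using vp by blast+
  then have "1/2 \<in> (\<lambda>z. z $ y) ` (graph_space C - {p})"
    unfolding coord using connectedD_interval[OF conn, of 0 1 "1/2"] by simp
  then show False using half by auto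
qed

section \<open>Cycles as lists of vertices\<close>

lemma cyc_seq_int: "cyc_seq L (int i) = L ! (i mod length L)"
  by (simp add: cyc_seq_def nat_mod_distrib)

lemma cyc_edges_eq:
  assumes "L \<noteq> []"
  shows "cyc_edges L = (\<lambda>i. {L ! i, L ! (Suc i mod length L)}) ` {..<length L}"
proof -
  have step: "{cyc_seq L j, cyc_seq L (j + 1)} = {L ! i, L ! (Suc i mod length L)}"
    if "i = nat (j mod int (length L))" for i j
  proof -
    have i: "int i = j mod int (length L)" unfolding that using assms by simp
    have "int (Suc i) mod int (length L) = (j + 1) mod int (length L)"
      unfolding of_nat_Suc i by (simp add: mod_add_right_eq add.commute)
    then have "cyc_seq L (j + 1) = L ! (Suc i mod length L)"
      unfolding cyc_seq_int[symmetric] by (simp add: cyc_seq_def)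
    then show ?thesis by (simp add: cyc_seq_def that)
  qed
  have "range (\<lambda>j. nat (j mod int (length L))) = {..<length L}"
  proof (intro equalityI subsetI)
    fix i assume "i \<in> {..<length L}"
    then have "i = nat (int i mod int (length L))" by simp
    then show "i \<in> range (\<lambda>j. nat (j mod int (length L)))" by (rule range_eqI)
  qed (use assms in \<open>auto simp: nat_less_iff\<close>)
  then show ?thesis unfolding cyc_edges_def step[OF refl] by (metis (no_types, lifting) image_image image_cong)
qed

lemma card_cyc_edges:
  assumes "distinct L" "3 \<le> length L"
  shows "card (cyc_edges L) = length L"
proof -
  let ?n = "length L"
  have n: "\<not> int ?n dvd 2" using assms(2) by (auto dest: zdvd_imp_le)
  have w: "cyc_seq L i = cyc_seq L j \<longleftrightarrow> int ?n dvd i - j" for i j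
    using cyclic_seq_cyc_seq[OF assms] by (simp add: cyclic_seq_def)
  have "inj_on (\<lambda>i. {cyc_seq L (int i), cyc_seq L (int i + 1)}) {..<?n}"
  proof (rule inj_onI)
    fix i j assume ij: "i \<in> {..<?n}" "j \<in> {..<?n}"
      and eq: "{cyc_seq L (int i), cyc_seq L (int i + 1)} = {cyc_seq L (int j), cyc_seq L (int j + 1)}"
    have "int ?n dvd int i - int j"
    proof (rule ccontr)
      assume "\<not> ?thesis"
      then have "int ?n dvd int i - (int j + 1)" "int ?n dvd (int i + 1) - int j"
        using eq unfolding w[symmetric] by (auto simp: doubleton_eq_iff)
      \<comment> \<open>Two equal edges at different indices would have to be traversed in opposite
        directions, which makes the length divide 2.\<close>
      from dvd_diff[OF this(2,1)] n show False by simp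
    qed
    then show "i = j" using ij by (auto simp: mod_eq_dvd_iff[symmetric])
  qed
  moreover have "cyc_edges L = (\<lambda>i. {cyc_seq L (int i), cyc_seq L (int i + 1)}) ` {..<?n}"
  proof -
    have "{L ! i, L ! (Suc i mod ?n)} = {cyc_seq L (int i), cyc_seq L (int i + 1)}" if "i < ?n" for i
      using that cyc_seq_int[of L i] cyc_seq_int[of L "Suc i"] by (simp add: add.commute)
    then show ?thesis using assms by (subst cyc_edges_eq) auto
  qed
  ultimately show ?thesis by (simp add: card_image)
qed

text \<open>On a longest path, the first vertex has a neighbour besides its successor. By maximality
  that neighbour lies on the path, and the initial piece up to it closes to a cycle.\<close>

lemma min_degree_two_imp_cycle:
  fixes C :: "'v::finite set set"
  assumes "simple_graph C" "C \<noteq> {}"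
    and deg: "\<And>x y. {x, y} \<in> C \<Longrightarrow> x \<noteq> y \<Longrightarrow> \<exists>z. z \<noteq> x \<and> z \<noteq> y \<and> {y, z} \<in> C"
  obtains L where "is_cycle C L"
proof -
  define P where "P L \<longleftrightarrow> distinct L \<and> 2 \<le> length L \<and> (\<forall>i. Suc i < length L \<longrightarrow> {L ! i, L ! Suc i} \<in> C)" for L
  obtain e where "e \<in> C" using assms(2) by blast
  then obtain a b where "a \<noteq> b" "{a, b} \<in> C" using assms(1) unfolding simple_graph_def by metis
  then have "P [a, b]" by (auto simp: P_def less_Suc_eq)
  moreover have "\<forall>L. P L \<longrightarrow> length L < Suc CARD('v)"
    by (metis P_def card_mono distinct_card finite le_imp_less_Suc subset_UNIV)
  ultimately obtain L where L: "P L" "\<And>L'. P L' \<Longrightarrow> length L' \<le> length L"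
    using ex_has_greatest_nat[of P "[a, b]" length] by blast
  then have len: "2 \<le> length L" and dist: "distinct L" by (auto simp: P_def)
  have e: "{L ! i, L ! Suc i} \<in> C" if "Suc i < length L" for i using L(1) that by (simp add: P_def)
  have "1 < length L" "0 < length L" using len by linarith+
  then have "L ! 1 \<noteq> L ! 0" using nth_eq_iff_index_eq[OF dist, of 1 0] by simp
  then obtain z where z: "z \<noteq> L ! 1" "z \<noteq> L ! 0" "{L ! 0, z} \<in> C"
    using deg[of "L ! 1" "L ! 0"] e[of 0] len by (auto simp: insert_commute)
  have "z \<in> set L"
  proof (rule ccontr)
    assume "z \<notin> set L"
    have "P (z # L)" unfolding P_def
    proof (intro conjI allI impI)
      fix i assume "Suc i < length (z # L)"
      then show "{(z # L) ! i, (z # L) ! Suc i} \<in> C"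
        using z(3) e by (cases i) (auto simp: insert_commute)
    qed (use \<open>z \<notin> set L\<close> dist len in auto)
    with L(2) show False by fastforce
  qed
  then obtain j where j: "j < length L" "z = L ! j" by (auto simp: in_set_conv_nth)
  \<comment> \<open>Since z is neither of the first two vertices, the initial piece ending in z has
    at least three.\<close>
  with z have "2 \<le> j" by (cases j; cases "j - 1") auto
  let ?L = "take (Suc j) L"
  have "is_cycle C ?L" unfolding is_cycle_def
  proof (intro conjI)
    show "cyc_edges ?L \<subseteq> C"
    proof -
      have "{?L ! i, ?L ! (Suc i mod length ?L)} \<in> C" if "i < length ?L" for i
      proof (cases "i = j")
        case True
        then show ?thesis using j z(3) by (simp add: insert_commute)
      next
        case False
        then show ?thesis using that j e[of i] by simp
      qed
      then show ?thesis using j by (subst cyc_edges_eq) auto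
    qed
  qed (use dist j \<open>2 \<le> j\<close> in auto)
  then show thesis by (rule that)
qed

text \<open>This passes from topology to combinatorics: a circle has no leaves, so it contains a
  combinatorial cycle; that cycle is itself a circle, and a circle has no proper circular
  subgraph.\<close>

lemma graph_cycles_eq:
  fixes E :: "'v::finite set set"
  assumes E: "simple_graph E"
  shows "graph_cycles k E = cyc_edges ` {L. is_cycle E L \<and> length L = k}"
proof
  have circle: "graph_space (cyc_edges L) homeomorphic sphere (0::complex) 1" if "is_cycle E L" for L and E :: "'v set set"
    using cyclic_seq_homeomorphic_circle[OF cyclic_seq_cyc_seq[of L]] that
    unfolding range_walk is_cycle_def cyc_edges_def by auto
  show "cyc_edges ` {L. is_cycle E L \<and> length L = k} \<subseteq> graph_cycles k E"
    using circle by (auto simp: graph_cycles_def is_cycle_def card_cyc_edges)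
  show "graph_cycles k E \<subseteq> cyc_edges ` {L. is_cycle E L \<and> length L = k}"
  proof
    fix C assume "C \<in> graph_cycles k E"
    then have C: "C \<subseteq> E" "card C = k" "graph_space C homeomorphic sphere (0::complex) 1"
      by (auto simp: graph_cycles_def)
    then have sC: "simple_graph C" using E by (auto simp: simple_graph_def)
    have "graph_space C \<noteq> {}"
    proof
      assume "graph_space C = {}"
      then have "sphere (0::complex) 1 = {}" using C(3) unfolding homeomorphic_def homeomorphism_def by force
      then show False by simp
    qed
    then have "C \<noteq> {}" by (auto simp: graph_space_def)
    obtain L where L: "is_cycle C L"
      by (rule min_degree_two_imp_cycle[OF sC \<open>C \<noteq> {}\<close> circle_graph_no_leaf[OF sC C(3)]])
    then have "cyc_edges L = C"
      using circle_subgraph_eq[OF sC C(3)] circle[OF L] by (auto simp: is_cycle_def)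
    moreover have "is_cycle E L" using L C(1) by (auto simp: is_cycle_def)
    moreover have "length L = k" using L C(2) \<open>cyc_edges L = C\<close> card_cyc_edges[of L] by (auto simp: is_cycle_def)
    ultimately show "C \<in> cyc_edges ` {L. is_cycle E L \<and> length L = k}" by blast
  qed
qed

section \<open>The Petersen graph\<close>

definition petersen_vertex :: "nat \<Rightarrow> 5 + 5" where
  "petersen_vertex n = (if n < 5 then Inl (of_nat n) else Inr (of_nat (n - 5)))"

text \<open>An explicit table, so that the enumeration can be evaluated.
  \<open>petersen_edge_iff\<close> ties it to the definition of the graph.\<close>

definition nbrs :: "nat \<Rightarrow> nat list" where
  "nbrs n = [[1,4,5],[0,2,6],[1,3,7],[2,4,8],[3,0,9],[0,7,8],[1,8,9],[2,9,5],[3,5,6],[4,6,7]] ! n"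

lemma of_nat_5_eq_iff: "(of_nat m :: 5) = of_nat n \<longleftrightarrow> m mod 5 = n mod 5"
  by (simp add: of_nat_eq_iff_cong_CHAR cong_def)

lemma range_of_nat_5: "of_nat ` {..<5} = (UNIV :: 5 set)"
proof (rule card_subset_eq)
  have "inj_on (of_nat :: nat \<Rightarrow> 5) {..<5}" by (intro inj_onI) (simp add: of_nat_5_eq_iff)
  then show "card (of_nat ` {..<5} :: 5 set) = card (UNIV :: 5 set)" by (simp add: card_image)
qed auto

lemma inj_petersen_vertex: "inj_on petersen_vertex {..<10}"
proof (rule inj_onI)
  fix x y :: nat assume xy: "x \<in> {..<10}" "y \<in> {..<10}" "petersen_vertex x = petersen_vertex y"
  have "z mod 5 = (if z < 5 then z else z - 5)" if "z < 10" for z :: nat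
    using that by (simp add: le_mod_geq)
  with xy show "x = y"
    by (auto simp: petersen_vertex_def of_nat_5_eq_iff split: if_splits)
qed

lemma range_petersen_vertex: "petersen_vertex ` {..<10} = UNIV"
proof (rule card_subset_eq)
  show "card (petersen_vertex ` {..<10}) = card (UNIV :: (5 + 5) set)"
    by (simp add: card_image[OF inj_petersen_vertex] card_UNIV_sum)
qed auto

lemma petersen_eq:
  "petersen = (\<Union>j<5. {{petersen_vertex j, petersen_vertex ((j + 1) mod 5)},
      {petersen_vertex j, petersen_vertex (j + 5)},
      {petersen_vertex (j + 5), petersen_vertex ((j + 2) mod 5 + 5)}})"
proof -
  have vertex: "petersen_vertex (m mod 5) = Inl (of_nat m)" "petersen_vertex (m mod 5 + 5) = Inr (of_nat m)" for m
    by (simp_all add: petersen_vertex_def of_nat_5_eq_iff)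
  have "petersen = (\<Union>j<5. {{Inl (of_nat j), Inl (of_nat (j + 1))}, {Inl (of_nat j), Inr (of_nat j)},
      {Inr (of_nat j), Inr (of_nat (j + 2))}})"
    unfolding petersen_def range_of_nat_5[symmetric] by (simp add: add.commute)
  also have "\<dots> = (\<Union>j<5. {{petersen_vertex j, petersen_vertex ((j + 1) mod 5)},
      {petersen_vertex j, petersen_vertex (j + 5)},
      {petersen_vertex (j + 5), petersen_vertex ((j + 2) mod 5 + 5)}})"
    unfolding vertex by (intro SUP_cong refl) (simp add: petersen_vertex_def)
  finally show ?thesis .
qed

lemma nbrs_table:
  "list_all (\<lambda>a. list_all (\<lambda>b. List.member (nbrs a) b \<longleftrightarrow> list_ex (\<lambda>j.
      a = j \<and> b = (j + 1) mod 5 \<or> a = (j + 1) mod 5 \<and> b = j \<or> a = j \<and> b = j + 5 \<or> a = j + 5 \<and> b = j \<or>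
      a = j + 5 \<and> b = (j + 2) mod 5 + 5 \<or> a = (j + 2) mod 5 + 5 \<and> b = j + 5) [0..<5]) [0..<10]) [0..<10]"
  by code_simp

lemma petersen_edge_iff:
  assumes "a < 10" "b < 10"
  shows "{petersen_vertex a, petersen_vertex b} \<in> petersen \<longleftrightarrow> b \<in> set (nbrs a)"
proof -
  have eq: "{petersen_vertex a, petersen_vertex b} = {petersen_vertex c, petersen_vertex d} \<longleftrightarrow>
      a = c \<and> b = d \<or> a = d \<and> b = c" if "c < 10" "d < 10" for c d
    using assms that by (simp add: doubleton_eq_iff inj_on_eq_iff[OF inj_petersen_vertex])
  have "(j + 1) mod 5 < 10" "(j + 2) mod 5 + 5 < 10" for j :: nat
    using mod_less_divisor[of 5 "j + 1"] mod_less_divisor[of 5 "j + 2"] by linarith+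
  then have "{petersen_vertex a, petersen_vertex b} \<in> petersen \<longleftrightarrow>
      (\<exists>j\<in>{0..<5}. a = j \<and> b = (j + 1) mod 5 \<or> a = (j + 1) mod 5 \<and> b = j \<or> a = j \<and> b = j + 5 \<or> a = j + 5 \<and> b = j \<or>
      a = j + 5 \<and> b = (j + 2) mod 5 + 5 \<or> a = (j + 2) mod 5 + 5 \<and> b = j + 5)"
    unfolding petersen_eq UN_iff insert_iff empty_iff by (intro bex_cong) (auto simp: eq)
  then show ?thesis
    using nbrs_table assms by (simp add: list_all_iff list_ex_iff del: upt_rec_numeral)
qed

lemma nbrs_bounded: "list_all (\<lambda>a. list_all (\<lambda>b. b < 10) (nbrs a)) [0..<10]"
  by code_simp

lemma simple_graph_petersen: "simple_graph petersen"
  unfolding simple_graph_def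
proof
  fix e assume "e \<in> petersen"
  then obtain i where "e = {Inl i, Inl (i + 1)} \<or> e = {Inl i, Inr i} \<or> e = {Inr i, Inr (i + 2)}"
    unfolding petersen_def by blast
  moreover have "(1::5) \<noteq> 0" "(2::5) \<noteq> 0"
    using of_nat_5_eq_iff[of 1 0] of_nat_5_eq_iff[of 2 0] by simp_all
  then have "(Inl i :: 5 + 5) \<noteq> Inl (i + 1)" "(Inl i :: 5 + 5) \<noteq> Inr i" "(Inr i :: 5 + 5) \<noteq> Inr (i + 2)"
    by simp_all
  ultimately show "\<exists>a b. a \<noteq> b \<and> e = {a, b}" by metis
qed

section \<open>Executable enumeration of cycles and corners\<close>

text \<open>Paths are stored backwards: the start \<open>v\<close>, which is also the least vertex, comes last.
  \<open>closed_paths n\<close> lists the cycles with \<open>n + 1\<close> edges, each in both directions.\<close>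

primrec paths_from :: "nat \<Rightarrow> nat \<Rightarrow> nat list list" where
  "paths_from v 0 = [[v]]"
| "paths_from v (Suc n) =
    concat (map (\<lambda>p. map (\<lambda>w. w # p) (filter (\<lambda>w. v < w \<and> w \<notin> set p) (nbrs (hd p)))) (paths_from v n))"

definition closed_paths :: "nat \<Rightarrow> nat list list" where
  "closed_paths n = concat (map (\<lambda>v. filter (\<lambda>p. v \<in> set (nbrs (hd p))) (paths_from v n)) [0..<10])"

text \<open>\<open>hd p\<close> and \<open>last (butlast p)\<close> are the two neighbours of the
  starting vertex on the cycle; comparing them selects one of the two directions.\<close>

definition cycle_reps :: "nat \<Rightarrow> nat list list" where
  "cycle_reps n = filter (\<lambda>p. hd p < last (butlast p)) (closed_paths n)"

text \<open>A canonical form: the two digits of a code are the ends of an edge, and sorting makes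
  equality of edge sets decidable by comparing lists.\<close>

definition edge_codes :: "nat list \<Rightarrow> nat list" where
  "edge_codes l = sorted_list_of_set (set (map (\<lambda>(a, b). 10 * min a b + max a b) (zip l (rotate1 l))))"

definition corners :: "nat list \<Rightarrow> (nat \<times> nat \<times> nat) list" where
  "corners l = zip l (zip (rotate1 l) (rotate1 (rotate1 l)))"

definition unoriented :: "nat \<times> nat \<times> nat \<Rightarrow> nat \<times> nat \<times> nat" where
  "unoriented = (\<lambda>(a, b, c). if a \<le> c then (a, b, c) else (c, b, a))"

text \<open>True when \<open>unoriented\<close> reverses the corner and the reversal changes the
  parity of its integer, i.e. when the middle vertex is a local extremum of the numbering.\<close>

definition sign_change :: "nat \<times> nat \<times> nat \<Rightarrow> bool" where
  "sign_change = (\<lambda>(a, b, c). \<not> a \<le> c \<and> (a < b \<longleftrightarrow> c < b))"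

text \<open>Two toggles of the same element cancel, so a list toggles to \<open>[]\<close> iff all its elements have even
  multiplicity.\<close>

primrec toggle :: "'a \<Rightarrow> 'a list \<Rightarrow> 'a list" where
  "toggle u [] = [u]"
| "toggle u (x # xs) = (if u = x then xs else x # toggle u xs)"

text \<open>For codes of representatives \<open>rs\<close> and of all closed paths
  \<open>cs\<close>: distinctness excludes counting a cycle twice, membership excludes missing
  one.\<close>

definition represented_once :: "nat list list \<Rightarrow> nat list list \<Rightarrow> bool" where
  "represented_once rs cs \<longleftrightarrow> distinct rs \<and> list_all (List.member rs) cs"

text \<open>The entire finite content of the theorem for cycles with \<open>n + 1\<close> edges:
  faithful representatives, cancelling corners, and an odd number of sign changes left over.\<close>

definition odd_cycle_count :: "nat \<Rightarrow> bool" where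
  "odd_cycle_count n \<longleftrightarrow>
    represented_once (map edge_codes (cycle_reps n)) (map edge_codes (closed_paths n)) \<and>
    fold toggle (map unoriented (concat (map corners (cycle_reps n)))) [] = [] \<and>
    odd (length (filter sign_change (concat (map corners (cycle_reps n)))))"

section \<open>Parity of sums over lists\<close>

lemma odd_sum_toggle:
  fixes F :: "'a \<Rightarrow> int"
  shows "odd (\<Sum>x\<leftarrow>toggle u xs. F x) \<longleftrightarrow> odd (F u + (\<Sum>x\<leftarrow>xs. F x))"
  by (induction xs) auto

lemma odd_sum_fold_toggle:
  fixes F :: "'a \<Rightarrow> int"
  shows "odd (\<Sum>x\<leftarrow>fold toggle us xs. F x) \<longleftrightarrow> odd ((\<Sum>x\<leftarrow>us. F x) + (\<Sum>x\<leftarrow>xs. F x))"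
  by (induction us arbitrary: xs) (auto simp: odd_sum_toggle)

lemma odd_sum_unoriented:
  fixes F :: "nat \<times> nat \<times> nat \<Rightarrow> int"
  assumes "\<And>t. t \<in> set ts \<Longrightarrow> odd (F t) \<longleftrightarrow> odd (F (unoriented t)) \<noteq> sign_change t"
  shows "odd (\<Sum>t\<leftarrow>ts. F t) \<longleftrightarrow>
    odd (\<Sum>t\<leftarrow>map unoriented ts. F t) \<noteq> odd (length (filter sign_change ts))"
  using assms by (induction ts) auto

section \<open>Correctness of the enumeration\<close>

lemma paths_from_bounded: "v < 10 \<Longrightarrow> p \<in> set (paths_from v n) \<Longrightarrow> hd p < 10 \<and> set p \<subseteq> {..<10}"
proof (induction n arbitrary: p)
  case (Suc n)
  then show ?case using nbrs_bounded by (fastforce simp: list_all_iff)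
qed simp

lemma in_paths_from_iff:
  "p \<in> set (paths_from v n) \<longleftrightarrow>
    distinct p \<and> length p = Suc n \<and> last p = v \<and> (\<forall>w\<in>set (butlast p). v < w) \<and>
    successively (\<lambda>w u. w \<in> set (nbrs u)) p"
proof (induction n arbitrary: p)
  case 0
  show ?case by (cases p) auto
next
  case (Suc n)
  have "p \<in> set (paths_from v (Suc n)) \<longleftrightarrow>
      (\<exists>w q. p = w # q \<and> q \<in> set (paths_from v n) \<and> w \<in> set (nbrs (hd q)) \<and> v < w \<and> w \<notin> set q)"
    by auto
  also have "\<dots> \<longleftrightarrow> (\<exists>w q. p = w # q \<and> q \<noteq> [] \<and> distinct p \<and> length p = Suc (Suc n) \<and> last p = v \<and>
      (\<forall>w\<in>set (butlast p). v < w) \<and> successively (\<lambda>w u. w \<in> set (nbrs u)) p)"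
    unfolding Suc.IH by (intro ex_cong1) (auto simp: successively_Cons split: if_splits)
  also have "\<dots> \<longleftrightarrow> distinct p \<and> length p = Suc (Suc n) \<and> last p = v \<and>
      (\<forall>w\<in>set (butlast p). v < w) \<and> successively (\<lambda>w u. w \<in> set (nbrs u)) p"
    by (cases p) auto
  finally show ?case .
qed

lemma in_zip_rotate1_iff:
  assumes "l \<noteq> []"
  shows "(\<forall>(a, b)\<in>set (zip l (rotate1 l)). P a b) \<longleftrightarrow> successively P l \<and> P (last l) (hd l)"
proof -
  have "(\<forall>(a, b)\<in>set (zip (x # xs) (xs @ [y])). P a b) \<longleftrightarrow> successively P (x # xs) \<and> P (last (x # xs)) y" for x xs y
    by (induction xs arbitrary: x) auto
  then show ?thesis using assms by (cases l) (simp_all add: last_ConsR)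
qed

lemma set_zip_rotate1: "set (zip l (rotate1 l)) = (\<lambda>i. (l ! i, l ! (Suc i mod length l))) ` {..<length l}"
  by (auto simp: set_zip nth_rotate1)

lemma cyc_edges_map:
  assumes "l \<noteq> []"
  shows "cyc_edges (map V l) = (\<lambda>(a, b). {V a, V b}) ` set (zip l (rotate1 l))"
  using assms by (subst cyc_edges_eq) (auto simp: set_zip_rotate1 image_image)

lemma cyc_seq_rotate1:
  assumes "L \<noteq> []"
  shows "cyc_seq (rotate1 L) j = cyc_seq L (j + 1)"
proof -
  let ?i = "nat (j mod int (length L))"
  have i: "int ?i = j mod int (length L)" and "?i < length L" using assms by (simp_all add: nat_less_iff)
  then have "cyc_seq (rotate1 L) j = L ! (Suc ?i mod length L)" by (simp add: cyc_seq_def nth_rotate1)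
  also have "\<dots> = cyc_seq L (int (Suc ?i))" by (simp only: cyc_seq_int)
  also have "\<dots> = cyc_seq L (j + 1)"
    unfolding cyc_seq_def of_nat_Suc i by (simp add: mod_add_right_eq add.commute)
  finally show ?thesis .
qed

lemma cyc_edges_rotate: "L \<noteq> [] \<Longrightarrow> cyc_edges (rotate k L) = cyc_edges L"
proof (induction k)
  case (Suc k)
  have "cyc_edges (rotate1 L) = cyc_edges L" if "L \<noteq> []" for L :: "'a list"
  proof -
    have "cyc_edges (rotate1 L) = (\<lambda>j. {cyc_seq L j, cyc_seq L (j + 1)}) ` range (\<lambda>j. j + 1)"
      unfolding cyc_edges_def image_image cyc_seq_rotate1[OF that] ..
    also have "range (\<lambda>j::int. j + 1) = UNIV" by (rule surjI[of _ "\<lambda>j. j - 1"]) simp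
    finally show ?thesis by (simp add: cyc_edges_def)
  qed
  then show ?case using Suc by simp
qed simp

lemma is_cycle_petersen_iff:
  assumes "set l \<subseteq> {..<10}"
  shows "is_cycle petersen (map petersen_vertex l) \<longleftrightarrow>
    distinct l \<and> 3 \<le> length l \<and> successively (\<lambda>w u. w \<in> set (nbrs u)) l \<and> last l \<in> set (nbrs (hd l))"
proof (cases "l = []")
  case False
  have "distinct (map petersen_vertex l) \<longleftrightarrow> distinct l"
    using assms inj_on_subset[OF inj_petersen_vertex] by (auto simp: distinct_map)
  moreover have "cyc_edges (map petersen_vertex l) \<subseteq> petersen \<longleftrightarrow>
      (\<forall>(a, b)\<in>set (zip l (rotate1 l)). a \<in> set (nbrs b))"
  proof -
    have "{petersen_vertex a, petersen_vertex b} \<in> petersen \<longleftrightarrow> a \<in> set (nbrs b)"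
      if "(a, b) \<in> set (zip l (rotate1 l))" for a b
    proof -
      have "a < 10" "b < 10" using set_zip_leftD[OF that] set_zip_rightD[OF that] assms by auto
      then show ?thesis using petersen_edge_iff[of b a] by (simp add: insert_commute)
    qed
    then show ?thesis unfolding cyc_edges_map[OF False] by fast
  qed
  ultimately show ?thesis by (simp add: is_cycle_def in_zip_rotate1_iff[OF False])
qed (simp add: is_cycle_def)

lemma closed_path_bounded: "p \<in> set (closed_paths n) \<Longrightarrow> set p \<subseteq> {..<10}"
  unfolding closed_paths_def using paths_from_bounded by (fastforce simp del: upt_rec_numeral)

lemma closed_path_is_cycle:
  assumes "2 \<le> n" "p \<in> set (closed_paths n)"
  shows "is_cycle petersen (map petersen_vertex p)" "length p = Suc n"
  using assms(1,2) is_cycle_petersen_iff[OF closed_path_bounded[OF assms(2)]]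
  by (auto simp: closed_paths_def in_paths_from_iff simp del: upt_rec_numeral)

lemma cycle_has_closed_path:
  assumes L: "is_cycle petersen L"
  obtains p where "p \<in> set (closed_paths (length L - 1))" "cyc_edges (map petersen_vertex p) = cyc_edges L"
proof -
  let ?idx = "inv_into {..<10} petersen_vertex"
  define l where "l = map ?idx L"
  have "petersen_vertex (?idx x) = x" "?idx x < 10" for x
    using f_inv_into_f[of x petersen_vertex "{..<10}"] inv_into_into[of x petersen_vertex "{..<10}"]
    by (simp_all add: range_petersen_vertex)
  then have l: "map petersen_vertex l = L" "set l \<subseteq> {..<10}" by (auto simp: l_def comp_def)
  have "l \<noteq> []" using L by (auto simp: l_def is_cycle_def)
  then obtain xs ys where xy: "l = xs @ Min (set l) # ys"
    using split_list[OF Min_in[of "set l"]] by auto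
  \<comment> \<open>Rotating one step past the least vertex brings it to the end of the list, where
    \<open>paths_from\<close> keeps its start.\<close>
  define p where "p = rotate (Suc (length xs)) l"
  have p: "p = ys @ xs @ [Min (set l)]"
    unfolding p_def by (subst xy) (simp add: rotate_append[of "xs @ [Min (set l)]" ys, simplified])
  have map_p: "map petersen_vertex p = rotate (Suc (length xs)) L"
    by (simp only: p_def rotate_map[symmetric] l(1))
  have "L \<noteq> []" using L by (auto simp: is_cycle_def)
  then have edges: "cyc_edges (map petersen_vertex p) = cyc_edges L"
    unfolding map_p by (rule cyc_edges_rotate)
  have len: "length p = length L" by (simp add: p_def l_def)
  have set_p: "set p = set l" by (simp add: p_def)
  have "is_cycle petersen (map petersen_vertex p)"
    using L unfolding is_cycle_def edges unfolding map_p by (simp del: rotate_Suc)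
  then have cyc: "distinct p" "3 \<le> length p" "successively (\<lambda>w u. w \<in> set (nbrs u)) p" "last p \<in> set (nbrs (hd p))"
    using is_cycle_petersen_iff[of p] set_p l(2) by auto
  have "Min (set l) < w" if "w \<in> set (butlast p)" for w
  proof -
    have "w \<in> set l" using that set_p by (auto dest: in_set_butlastD)
    moreover have "w \<noteq> Min (set l)" using that cyc(1) by (auto simp: p butlast_append)
    ultimately show ?thesis using Min_le[of "set l" w] by (simp add: less_le)
  qed
  moreover have "Min (set l) \<in> set l" using \<open>l \<noteq> []\<close> by simp
  then have "Min (set l) < 10" using l(2) by blast
  ultimately have "p \<in> set (closed_paths (length L - 1))"
    using cyc len by (auto simp: closed_paths_def in_paths_from_iff p simp del: upt_rec_numeral)
  then show thesis using edges by (rule that)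
qed

lemma graph_cycles_petersen:
  assumes "2 \<le> n"
  shows "graph_cycles (Suc n) petersen = (\<lambda>p. cyc_edges (map petersen_vertex p)) ` set (closed_paths n)"
proof (intro equalityI subsetI)
  fix C assume "C \<in> graph_cycles (Suc n) petersen"
  then obtain L where "is_cycle petersen L" "length L = Suc n" "C = cyc_edges L"
    unfolding graph_cycles_eq[OF simple_graph_petersen] by blast
  then show "C \<in> (\<lambda>p. cyc_edges (map petersen_vertex p)) ` set (closed_paths n)"
    by (elim cycle_has_closed_path) force
next
  fix C assume "C \<in> (\<lambda>p. cyc_edges (map petersen_vertex p)) ` set (closed_paths n)"
  then show "C \<in> graph_cycles (Suc n) petersen"
    unfolding graph_cycles_eq[OF simple_graph_petersen] using closed_path_is_cycle[OF assms] by force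
qed

text \<open>The maps \<open>dec\<close> and \<open>enc\<close> translate between codes and edges in
  both directions. Base 10 loses nothing because all vertex numbers are below 10.\<close>

lemma edge_codes_eq_iff:
  assumes "p \<noteq> []" "q \<noteq> []" "set p \<subseteq> {..<10}" "set q \<subseteq> {..<10}"
  shows "edge_codes p = edge_codes q \<longleftrightarrow>
    cyc_edges (map petersen_vertex p) = cyc_edges (map petersen_vertex q)"
proof -
  define c where "c = (\<lambda>(a, b). 10 * min a b + max a b :: nat)"
  define dec where "dec x = {petersen_vertex (x div 10), petersen_vertex (x mod 10)}" for x
  define enc where "enc e = (let S = inv_into {..<10} petersen_vertex ` e in 10 * Min S + Max S)" for e
  have pairs: "dec (c t) = (\<lambda>(a, b). {petersen_vertex a, petersen_vertex b}) t \<and>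
      enc ((\<lambda>(a, b). {petersen_vertex a, petersen_vertex b}) t) = c t"
    if t: "t \<in> set (zip l (rotate1 l))" and l: "set l \<subseteq> {..<10}" for t l
  proof -
    obtain a b where t': "t = (a, b)" by (cases t)
    then have "a \<in> set l" "b \<in> set l" using set_zip_leftD[of a b] set_zip_rightD[of a b] t by fastforce+
    then have ab: "t = (a, b)" "a < 10" "b < 10" using t' l by auto
    then have "(10 * min a b + max a b) div 10 = min a b" "(10 * min a b + max a b) mod 10 = max a b"
      by (auto simp: min_def max_def)
    then show ?thesis using ab inv_into_f_f[OF inj_petersen_vertex]
      by (auto simp: c_def dec_def enc_def min_def max_def insert_commute)
  qed
  let ?K = "\<lambda>l. c ` set (zip l (rotate1 l))" and ?E = "\<lambda>l. cyc_edges (map petersen_vertex l)"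
  have "?E l = dec ` ?K l \<and> ?K l = enc ` ?E l" if "l \<noteq> []" "set l \<subseteq> {..<10}" for l
    unfolding cyc_edges_map[OF that(1)] image_image using pairs[OF _ that(2)] by (auto intro!: image_cong)
  then have "?K p = ?K q \<longleftrightarrow> ?E p = ?E q" using assms by metis
  moreover have "edge_codes l = sorted_list_of_set (?K l)" for l by (simp add: edge_codes_def c_def)
  ultimately show ?thesis using sorted_list_of_set_inject[of "?K p" "?K q"] by auto
qed

section \<open>Summation over all cycles of one length\<close>

lemma nth_corners:
  assumes "i < length p"
  shows "corners p ! i = (p ! i, p ! (Suc i mod length p), p ! (Suc (Suc i) mod length p))"
proof -
  have "Suc i mod length p < length p" using assms by (intro mod_less_divisor) auto
  then show ?thesis using assms by (simp add: corners_def nth_rotate1 mod_Suc_eq)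
qed

lemma cyc_seq_map_corner:
  assumes "p \<noteq> []"
  shows "cyc_seq (map V p) (int i) = V (p ! (i mod length p))"
    "cyc_seq (map V p) (int i + 1) = V (p ! (Suc i mod length p))"
    "cyc_seq (map V p) (int i + 2) = V (p ! (Suc (Suc i) mod length p))"
proof -
  have *: "cyc_seq (map V p) (int j) = V (p ! (j mod length p))" for j
    using assms by (simp add: cyc_seq_int)
  have "int i + 1 = int (Suc i)" "int i + 2 = int (Suc (Suc i))" by simp_all
  then show "cyc_seq (map V p) (int i) = V (p ! (i mod length p))"
    "cyc_seq (map V p) (int i + 1) = V (p ! (Suc i mod length p))"
    "cyc_seq (map V p) (int i + 2) = V (p ! (Suc (Suc i) mod length p))"
    by (simp_all only: *)
qed

text \<open>Exchanging cycles for corners: modulo 2 the double sum runs over all corners of the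
  representatives. Turning every corner into its unoriented form costs one unit per sign change, and
  what remains cancels in pairs whatever the unknown integers are.\<close>

lemma odd_sum_rotation_numbers:
  assumes f: "locally_injective_graph_map petersen f r"
    and n: "2 \<le> n" "odd_cycle_count n"
    and \<gamma>: "\<And>C. C \<in> graph_cycles (Suc n) petersen \<Longrightarrow> parametrizes (\<gamma> C) C"
  shows "[(\<Sum>C\<in>graph_cycles (Suc n) petersen. rotation_number (f \<circ> \<gamma> C)) = 1] (mod 2)"
proof -
  interpret locally_injective_graph_map petersen f r by (rule f)
  let ?V = petersen_vertex and ?R = "cycle_reps n" and ?E = "\<lambda>p. cyc_edges (map petersen_vertex p)"
  \<comment> \<open>This numbering serves as \<open>idx\<close>, so the sign rule becomes a
    comparison of the numbers used in the enumeration.\<close>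
  have "inj (inv_into {..<10} ?V)"
    using inj_on_inv_into[of UNIV ?V "{..<10}"] by (simp add: range_petersen_vertex)
  from corner_integers[OF this] obtain m where
    m: "\<And>a b c. corner a b c \<Longrightarrow> odd (m a b c + m c b a) \<longleftrightarrow>
        (inv_into {..<10} ?V a < inv_into {..<10} ?V b \<longleftrightarrow> inv_into {..<10} ?V c < inv_into {..<10} ?V b)"
    and rot: "\<And>L g. is_cycle petersen L \<Longrightarrow> parametrizes g (cyc_edges L) \<Longrightarrow>
      [rotation_number (f \<circ> g) =
        (\<Sum>i<length L. m (cyc_seq L (int i)) (cyc_seq L (int i + 1)) (cyc_seq L (int i + 2)))] (mod 2)"
    by blast
  define M where "M = (\<lambda>(a, b, c). m (?V a) (?V b) (?V c))"
  have cyc: "is_cycle petersen (map ?V p)" "p \<noteq> []" "set p \<subseteq> {..<10}" if "p \<in> set (closed_paths n)" for p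
    using closed_path_is_cycle[OF n(1) that] closed_path_bounded[OF that] by auto
  have reps: "set ?R \<subseteq> set (closed_paths n)" by (auto simp: cycle_reps_def)
  have once: "represented_once (map edge_codes ?R) (map edge_codes (closed_paths n))"
    using n(2) by (simp add: odd_cycle_count_def)
  have codes: "edge_codes p = edge_codes q \<longleftrightarrow> ?E p = ?E q"
    if "p \<in> set (closed_paths n)" "q \<in> set (closed_paths n)" for p q
    by (intro edge_codes_eq_iff cyc that)
  have image: "graph_cycles (Suc n) petersen = ?E ` set ?R"
  proof -
    have "\<exists>q\<in>set ?R. ?E p = ?E q" if p: "p \<in> set (closed_paths n)" for p
    proof -
      have "edge_codes p \<in> edge_codes ` set ?R"
        using once p by (auto simp: represented_once_def list_all_iff)
      then obtain q where "q \<in> set ?R" "edge_codes p = edge_codes q" by blast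
      then show ?thesis using codes[OF p, of q] reps by blast
    qed
    then show ?thesis unfolding graph_cycles_petersen[OF n(1)] using reps by blast
  qed
  have dist: "distinct (map edge_codes ?R)" using once by (simp add: represented_once_def)
  have inj: "inj_on ?E (set ?R)"
  proof (rule inj_onI)
    fix p q assume pq: "p \<in> set ?R" "q \<in> set ?R" "?E p = ?E q"
    then have "edge_codes p = edge_codes q" using codes[of p q] reps by blast
    then show "p = q" using dist pq by (auto simp: distinct_map dest: inj_onD)
  qed
  have corner_sum: "(\<Sum>i<length p. m (cyc_seq (map ?V p) (int i)) (cyc_seq (map ?V p) (int i + 1)) (cyc_seq (map ?V p) (int i + 2)))
      = (\<Sum>t\<leftarrow>corners p. M t)" if "p \<noteq> []" for p
  proof -
    have "length (corners p) = length p" by (simp add: corners_def)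
    then show ?thesis
      using that by (simp add: sum_list_sum_nth atLeast0LessThan nth_corners M_def cyc_seq_map_corner)
  qed
  have "[(\<Sum>C\<in>graph_cycles (Suc n) petersen. rotation_number (f \<circ> \<gamma> C)) =
      (\<Sum>p\<in>set ?R. \<Sum>t\<leftarrow>corners p. M t)] (mod 2)"
    unfolding image sum.reindex[OF inj] comp_def[of _ ?E]
  proof (rule cong_sum)
    fix p assume p: "p \<in> set ?R"
    then have "parametrizes (\<gamma> (?E p)) (?E p)" using \<gamma> image by blast
    then show "[rotation_number (f \<circ> \<gamma> (?E p)) = (\<Sum>t\<leftarrow>corners p. M t)] (mod 2)"
      using rot[OF cyc(1)] cyc(2) p reps corner_sum[of p] by fastforce
  qed
  also have "(\<Sum>p\<in>set ?R. \<Sum>t\<leftarrow>corners p. M t) = (\<Sum>p\<leftarrow>?R. \<Sum>t\<leftarrow>corners p. M t)"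
    using dist by (simp add: distinct_map sum_list_distinct_conv_sum_set)
  also have "(\<Sum>p\<leftarrow>R. \<Sum>t\<leftarrow>corners p. M t) = (\<Sum>t\<leftarrow>concat (map corners R). M t)" for R
    by (induction R) simp_all
  finally have main: "[(\<Sum>C\<in>graph_cycles (Suc n) petersen. rotation_number (f \<circ> \<gamma> C)) =
      (\<Sum>t\<leftarrow>concat (map corners ?R). M t)] (mod 2)" .
  have parity: "odd (M t) \<longleftrightarrow> odd (M (unoriented t)) \<noteq> sign_change t"
    if t: "t \<in> set (concat (map corners ?R))" for t
  proof -
    obtain p where p: "p \<in> set (closed_paths n)" "t \<in> set (corners p)" using t reps by auto
    then obtain i where i: "i < length p" "t = corners p ! i" by (auto simp: in_set_conv_nth corners_def)
    obtain a b c where abc: "t = (a, b, c)" by (cases t)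
    have "corner (?V a) (?V b) (?V c)"
      using cycle_corner[OF cyc(1)[OF p(1)], of "int i"] abc i
      by (simp add: nth_corners cyc_seq_map_corner cyc(2)[OF p(1)])
    moreover have "p ! (j mod length p) < 10" for j
    proof -
      have "p ! (j mod length p) \<in> set p" using i by (intro nth_mem mod_less_divisor) auto
      then show ?thesis using cyc(3)[OF p(1)] by blast
    qed
    then have "a < 10" "b < 10" "c < 10"
      using i abc by (metis nth_corners mod_less prod.inject)+
    ultimately have "odd (m (?V a) (?V b) (?V c) + m (?V c) (?V b) (?V a)) \<longleftrightarrow> (a < b \<longleftrightarrow> c < b)"
      using m inv_into_f_f[OF inj_petersen_vertex] by simp
    then show ?thesis by (auto simp: abc M_def unoriented_def sign_change_def)
  qed
  \<comment> \<open>The toggled list is empty, so the sum over unoriented corners is even and only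
    the odd number of sign changes survives.\<close>
  have "odd (\<Sum>t\<leftarrow>concat (map corners ?R). M t)"
    using odd_sum_unoriented[of "concat (map corners ?R)" M, OF parity]
      odd_sum_fold_toggle[of M "map unoriented (concat (map corners ?R))" "[]"] n(2)
    by (simp add: odd_cycle_count_def)
  with main show ?thesis by (simp add: cong_def odd_iff_mod_2_eq_one)
qed

text \<open>The parameter is one less than the number of edges: these are the lengths 5, 6, 8 and
  9.\<close>

lemma odd_cycle_counts: "odd_cycle_count 4" "odd_cycle_count 5" "odd_cycle_count 7" "odd_cycle_count 8"
  by code_simp+

theorem corollary1p13:
  fixes f :: "real ^ (5 + 5) \<Rightarrow> complex"
    and \<gamma> :: "(5 + 5) set set \<Rightarrow> real \<Rightarrow> real ^ (5 + 5)"
  assumes "plane_generic_immersion petersen f"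
    and "\<And>k C. C \<in> graph_cycles k petersen \<Longrightarrow> parametrizes (\<gamma> C) C"
  shows "[(\<Sum>C\<in>graph_cycles 5 petersen. rotation_number (f \<circ> \<gamma> C)) = 1] (mod 2) \<and>
         [(\<Sum>C\<in>graph_cycles 6 petersen. rotation_number (f \<circ> \<gamma> C)) = 1] (mod 2) \<and>
         [(\<Sum>C\<in>graph_cycles 8 petersen. rotation_number (f \<circ> \<gamma> C)) = 1] (mod 2) \<and>
         [(\<Sum>C\<in>graph_cycles 9 petersen. rotation_number (f \<circ> \<gamma> C)) = 1] (mod 2)"
proof -
  obtain r where f: "locally_injective_graph_map petersen f r"
    using assms(1) plane_immersion_locally_injective unfolding plane_generic_immersion_def by blast
  show ?thesis
    using odd_sum_rotation_numbers[OF f _ odd_cycle_counts(1) assms(2)]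
      odd_sum_rotation_numbers[OF f _ odd_cycle_counts(2) assms(2)]
      odd_sum_rotation_numbers[OF f _ odd_cycle_counts(3) assms(2)]
      odd_sum_rotation_numbers[OF f _ odd_cycle_counts(4) assms(2)] by simp
qed

end
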